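(* For every $\alpha\in(1,2)$, $$H_0^{\alpha/2}(\mathbb R_* )=H^{\alpha/2}(\mathbb R)\cap\bigcap_{1<\beta<\alpha}H_0^{\beta/2}(\mathbb R_* )$$ and $$H_0^{\alpha/2}(\mathbb R_* )=\{u\in H^{\alpha/2}(\mathbb R):u(0)=0\}.$$
   Context: $\mathbb R_*=\mathbb R\setminus\{0\}$. For $\beta\in(0,2)$ let $q_\beta(y):=c_\beta|y|^{-1-\beta}$ with $c_\beta:=\frac{2^\beta\Gamma((1+\beta)/2)}{\sqrt\pi|\Gamma(-\beta/2)|}$, and for Borel $u:\mathbb R\to\mathbb R$ let $\mathcal E[u]:=\frac12\int_{\mathbb R^2}[u(y')-u(y)]^2q_\beta(y'-y)\,dy\,dy'\in[0,+\infty]$. $H^{\beta/2}(\mathbb R):=\{u\in L^2(\mathbb R):\mathcal E[u]<\infty\}$ with norm $\|u\|_{H^{\beta/2}(\mathbb R)}:=(\|u\|_{L^2(\mathbb R)}^2+\mathcal E[u])^{1/2}$, and $H_0^{\beta/2}(\mathbb R_* )$ is the completion of $C_c^\infty(\mathbb R_* )$ under this norm, viewed as a subspace of $H^{\beta/2}(\mathbb R)$. When $\alpha>1$ one has $H^{\alpha/2}(\mathbb R)\subset C_b(\mathbb R)$, and $u(0)$ is the value at $0$ of the continuous representative of $u$. *)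

theory Defs
  imports "HOL-Analysis.Analysis"
begin

definition kernel_const :: "real \<Rightarrow> real" where
  "kernel_const \<beta> =
     2 powr \<beta> * Gamma ((1 + \<beta>) / 2) / (sqrt pi * \<bar>Gamma (- \<beta> / 2)\<bar>)"

(* The value at 0 is 0 by the convention 0 powr a = 0. It only enters the energy on the
   diagonal, where the increment of u vanishes as well. *)
definition jump_kernel :: "real \<Rightarrow> real \<Rightarrow> real" where
  "jump_kernel \<beta> y = kernel_const \<beta> * \<bar>y\<bar> powr (- 1 - \<beta>)"

definition energy :: "real \<Rightarrow> (real \<Rightarrow> real) \<Rightarrow> ennreal" where
  "energy \<beta> u =
     (1 / 2) * (\<integral>\<^sup>+ (y, y'). ennreal ((u y' - u y)\<^sup>2 * jump_kernel \<beta> (y' - y))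
                 \<partial>(lborel \<Otimes>\<^sub>M lborel))"

(* H^(\<beta>/2)(R): note that the index is \<beta>, twice the order of smoothness. Elements are Borel
   functions rather than classes modulo equality almost everywhere. *)
definition sobolev :: "real \<Rightarrow> (real \<Rightarrow> real) set" where
  "sobolev \<beta> = {u \<in> borel_measurable borel.
                  integrable lborel (\<lambda>x. (u x)\<^sup>2) \<and> energy \<beta> u < \<infinity>}"

(* Meaningful on sobolev \<beta>, where the energy is finite and enn2real loses nothing. *)
definition sobolev_norm :: "real \<Rightarrow> (real \<Rightarrow> real) \<Rightarrow> real" where
  "sobolev_norm \<beta> u = sqrt ((\<integral>x. (u x)\<^sup>2 \<partial>lborel) + enn2real (energy \<beta> u))"

(* C_c^\<infinity>(R - {0}), each function being extended by 0 to the origin; since the closed support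
   avoids 0, the extension is smooth on R. *)
definition test_functions :: "(real \<Rightarrow> real) set" where
  "test_functions = {\<phi>. (\<forall>k x. (deriv ^^ k) \<phi> differentiable (at x)) \<and>
                        compact (closure {x. \<phi> x \<noteq> 0}) \<and>
                        closure {x. \<phi> x \<noteq> 0} \<subseteq> - {0}}"

(* H_0^(\<beta>/2)(R - {0}): the completion of the test functions, realised inside H^(\<beta>/2)(R) as the
   set of limits of sequences of test functions. Like sobolev \<beta>, this set is closed under
   modification on null sets (within Borel functions). *)
definition sobolev0 :: "real \<Rightarrow> (real \<Rightarrow> real) set" where
  "sobolev0 \<beta> = {u \<in> sobolev \<beta>. \<exists>\<phi> :: nat \<Rightarrow> real \<Rightarrow> real.
                   (\<forall>n. \<phi> n \<in> test_functions) \<and>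
                   (\<lambda>n. sobolev_norm \<beta> (\<lambda>x. u x - \<phi> n x)) \<longlonglongrightarrow> 0}"

(* Unique when it exists; it exists for every u in sobolev \<alpha> if 1 < \<alpha> < 2. *)
definition continuous_representative :: "(real \<Rightarrow> real) \<Rightarrow> real \<Rightarrow> real" where
  "continuous_representative u =
     (THE v. continuous_on UNIV v \<and> (AE x in lborel. u x = v x))"

end

(* Let B be a smooth mollifier supported in [-1, 1], and let u_r be the average of the translates
   u (x - r s) against B(s) ds. Since |x - x'| <= 2 r on the range of the averages, Jensen's
   inequality bounds the square of u_r - u_(r/2) by r^(beta - 1) times the energy of u. For beta > 1
   the dyadic averages therefore converge uniformly; the limit is the continuous representative,
   it vanishes at infinity, and its values are bounded by the norm of u. So the value at 0
   passes to limits, which gives u(0) = 0 on the completion.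

   Conversely, if u(0) = 0, soft thresholding of the continuous representative at height 1/n gives a
   continuous function with compact support away from 0, which is then mollified. Neither operation
   increases the energy or the L^2 norm, so pointwise convergence together with Scheffe's lemma
   gives convergence in norm; no Hardy inequality is needed. The condition u(0) = 0 does not involve
   the exponent, hence the intersection formula. *)

theory Submission
  imports Defs
begin

subsection \<open>Smooth functions and the mollifier\<close>

text \<open>The approximation works because both operations act on increments. Soft thresholding
  does not enlarge any |v x - v y|, and an increment of a mollification is an average of increments
  over pairs of points at the same distance. The kernel is therefore never estimated: the norms of
  the approximants are bounded by the norm of u for free, and Scheffe's lemma asks for no more than
  this bound. Multiplying by a cut-off near 0 would instead create a term in which u meets the steep
  slope of the cut-off. Thresholding cuts in the values: by continuity the set where |v| > 1/n stays
  away from a zero of v, and by decay at infinity it is bounded. The power r^(\<beta> - 1) is a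
  balance. At distance at most 2 r the kernel is at least (2 r)^(-1 - \<beta>), so replacing 1 by
  the kernel costs a multiple of r^(1 + \<beta>), while the substitutions in the two averages
  contribute a multiple of r^(-2).\<close>

definition smooth :: "(real \<Rightarrow> real) \<Rightarrow> bool" where
  "smooth f \<longleftrightarrow> (\<forall>k x. (deriv ^^ k) f differentiable (at x))"

text \<open>Iterated \<open>deriv\<close> is awkward to compute. It suffices to exhibit a class of
  functions in which every member has a derivative in the class, since then all iterates stay inside
  it.\<close>

lemma smooth_coinduct:
  assumes "f \<in> S"
    and step: "\<And>g. g \<in> S \<Longrightarrow> \<exists>g'\<in>S. \<forall>x. (g has_real_derivative g' x) (at x)"
  shows "smooth f"
proof -
  have "(deriv ^^ k) f \<in> S" for k
  proof (induction k)
    case (Suc k)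
    obtain g' where "g' \<in> S" "\<forall>x. ((deriv ^^ k) f has_real_derivative g' x) (at x)"
      using step[OF Suc] by blast
    then show ?case
      using DERIV_imp_deriv[of "(deriv ^^ k) f"] by (metis comp_apply ext funpow.simps(2))
  qed (use assms in simp)
  then show ?thesis
    unfolding smooth_def using step by (metis real_differentiable_def)
qed

lemma smooth_has_derivative:
  assumes "smooth f"
  shows "(f has_real_derivative deriv f x) (at x)"
proof -
  have "(deriv ^^ 0) f differentiable (at x)"
    using assms unfolding smooth_def by blast
  then show ?thesis
    by (metis DERIV_imp_deriv funpow_0 real_differentiable_def)
qed

lemma smooth_deriv:
  assumes "smooth f"
  shows "smooth (deriv f)"
proof -
  have "(deriv ^^ k) (deriv f) differentiable (at x)" for k x
    using assms unfolding smooth_def by (metis comp_apply funpow_Suc_right)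
  then show ?thesis
    unfolding smooth_def by blast
qed

lemma smooth_continuous_on: "smooth f \<Longrightarrow> continuous_on A f"
  by (meson DERIV_isCont continuous_at_imp_continuous_on smooth_has_derivative)

lemma smooth_cmult:
  assumes "smooth f"
  shows "smooth (\<lambda>x. c * f x)"
proof (rule smooth_coinduct)
  show "(\<lambda>x. c * f x) \<in> {\<lambda>x. c * g x |g. smooth g}"
    using assms by blast
next
  fix h assume "h \<in> {\<lambda>x. c * g x |g. smooth g}"
  then obtain g where g: "h = (\<lambda>x. c * g x)" "smooth g"
    by blast
  then have "\<forall>x. (h has_real_derivative c * deriv g x) (at x)"
    by (auto intro!: derivative_eq_intros smooth_has_derivative)
  then show "\<exists>g'\<in>{\<lambda>x. c * g x |g. smooth g}. \<forall>x. (h has_real_derivative g' x) (at x)"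
    using smooth_deriv[OF g(2)] by (intro bexI[of _ "\<lambda>x. c * deriv g x"]) auto
qed

lemma smooth_affine:
  assumes "smooth f"
  shows "smooth (\<lambda>x. f (a * x + b))"
proof (rule smooth_coinduct)
  \<comment> \<open>The free factor c absorbs the factor a that each differentiation
    produces.\<close>
  let ?S = "{\<lambda>x. c * g (a * x + b) |c g. smooth g}"
  have "(\<lambda>x. f (a * x + b)) = (\<lambda>x. 1 * f (a * x + b))"
    by simp
  then show "(\<lambda>x. f (a * x + b)) \<in> ?S"
    using assms by blast
  fix h assume "h \<in> ?S"
  then obtain c g where g: "h = (\<lambda>x. c * g (a * x + b))" "smooth g"
    by blast
  have "(h has_real_derivative (c * a) * deriv g (a * x + b)) (at x)" for x
    unfolding g(1)
    by (rule DERIV_chain'[where f = "\<lambda>x. a * x + b", OF _ smooth_has_derivative[OF g(2)], THEN DERIV_cmult, THEN DERIV_cong])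
      (auto intro!: derivative_eq_intros)
  then show "\<exists>g'\<in>?S. \<forall>x. (h has_real_derivative g' x) (at x)"
    using smooth_deriv[OF g(2)] by (intro bexI[of _ "\<lambda>x. (c * a) * deriv g (a * x + b)"]) auto
qed

text \<open>By the Leibniz rule, the sums of products of smooth functions are closed under
  differentiation.\<close>

inductive smooth_products :: "(real \<Rightarrow> real) \<Rightarrow> bool" where
  mult: "smooth f \<Longrightarrow> smooth g \<Longrightarrow> smooth_products (\<lambda>x. f x * g x)"
| add: "smooth_products f \<Longrightarrow> smooth_products g \<Longrightarrow> smooth_products (\<lambda>x. f x + g x)"

lemma smooth_mult:
  assumes "smooth f" "smooth g"
  shows "smooth (\<lambda>x. f x * g x)"
proof (rule smooth_coinduct)
  show "(\<lambda>x. f x * g x) \<in> {h. smooth_products h}"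
    using assms by (simp add: smooth_products.mult)
next
  fix h assume "h \<in> {h. smooth_products h}"
  then have "smooth_products h"
    by simp
  then show "\<exists>g'\<in>{h. smooth_products h}. \<forall>x. (h has_real_derivative g' x) (at x)"
  proof (induction h)
    case (mult f g)
    have "((\<lambda>x. f x * g x) has_real_derivative deriv f x * g x + f x * deriv g x) (at x)" for x
      using DERIV_mult[OF smooth_has_derivative[OF mult(1)] smooth_has_derivative[OF mult(2)]]
      by (simp add: mult.commute)
    moreover have "smooth_products (\<lambda>x. deriv f x * g x + f x * deriv g x)"
      by (intro smooth_products.intros smooth_deriv mult)
    ultimately show ?case
      by (intro bexI[of _ "\<lambda>x. deriv f x * g x + f x * deriv g x"]) auto
  next
    case (add f g)
    then obtain f' g' where "smooth_products f'" "\<forall>x. (f has_real_derivative f' x) (at x)"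
      "smooth_products g'" "\<forall>x. (g has_real_derivative g' x) (at x)"
      by auto
    then show ?case
      by (intro bexI[of _ "\<lambda>x. f' x + g' x"]) (auto intro: DERIV_add smooth_products.add)
  qed
qed

text \<open>The polynomial factor makes this class closed under differentiation.\<close>

definition flat :: "real poly \<Rightarrow> real \<Rightarrow> real" where
  "flat p x = (if x > 0 then poly p (1 / x) * exp (- 1 / x) else 0)"

lemma poly_times_exp_minus_tendsto:
  fixes p :: "real poly"
  shows "((\<lambda>t. poly p t * exp (- t)) \<longlongrightarrow> 0) at_top"
proof -
  have "((\<lambda>t. \<Sum>i\<le>degree p. coeff p i * (t ^ i / exp t)) \<longlongrightarrow> (\<Sum>i\<le>degree p. coeff p i * 0)) at_top"
    by (intro tendsto_intros tendsto_power_div_exp_0)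
  then show ?thesis
    by (simp add: poly_altdef exp_minus sum_distrib_right divide_inverse mult.assoc)
qed

lemma flat_at_right_0: "(flat p \<longlongrightarrow> 0) (at_right 0)"
proof -
  have "((\<lambda>x. poly p (inverse x) * exp (- inverse x)) \<longlongrightarrow> 0) (at_right 0)"
    by (rule filterlim_compose[OF poly_times_exp_minus_tendsto filterlim_inverse_at_top_right])
  then show ?thesis
    by (rule Lim_transform_eventually)
      (auto simp: eventually_at_filter flat_def divide_inverse)
qed

text \<open>With t = 1/x one has d/dx = - t^2 d/dt, and p(t) exp(-t) has t-derivative (p' - p)(t)
  exp(-t). This yields the polynomial t^2 (p - p'), where \<open>[:0, 0, 1:]\<close> is t^2.\<close>

lemma flat_has_derivative:
  "(flat p has_real_derivative flat ([:0, 0, 1:] * (p - pderiv p)) x) (at x)"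
proof -
  consider "x < 0" | "x = 0" | "x > 0" by linarith
  then show ?thesis
  proof cases
    case 1
    have "((\<lambda>x. 0) has_real_derivative 0) (at x)" by simp
    then have "(flat p has_real_derivative 0) (at x)"
      by (rule has_field_derivative_transform_within_open[where S = "{..<0}"])
        (use 1 in \<open>auto simp: flat_def\<close>)
    then show ?thesis
      using 1 by (simp add: flat_def)
  next
    case 2
    \<comment> \<open>Division by h > 0 multiplies the polynomial in 1/h by its variable, so the
      difference quotient at 0 is \<open>flat (pCons 0 p) h\<close>, again a flat function.\<close>
    have "((\<lambda>h. flat p h / h) \<longlongrightarrow> 0) (at_right 0)"
      by (rule Lim_transform_eventually[OF flat_at_right_0[of "pCons 0 p"]])
        (auto simp: eventually_at_filter flat_def)
    moreover have "((\<lambda>h. flat p h / h) \<longlongrightarrow> 0) (at_left 0)"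
      by (rule Lim_transform_eventually[OF tendsto_const])
        (auto simp: eventually_at_filter flat_def)
    ultimately have "((\<lambda>h. flat p h / h) \<longlongrightarrow> 0) (at 0)"
      by (simp add: filterlim_at_split)
    then show ?thesis
      by (simp add: 2 DERIV_def flat_def)
  next
    case 3
    have "((\<lambda>x. poly p (1 / x) * exp (- 1 / x)) has_real_derivative
            flat ([:0, 0, 1:] * (p - pderiv p)) x) (at x)"
    proof -
      have 1: "((\<lambda>x. 1 / x) has_real_derivative - 1 / x^2) (at x)"
        using 3 by (auto intro!: derivative_eq_intros simp: power2_eq_square)
      have 2: "((\<lambda>x. exp (- 1 / x)) has_real_derivative exp (- 1 / x) * (1 / x^2)) (at x)"
        using 3 by (auto intro!: derivative_eq_intros simp: power2_eq_square)
      have "((\<lambda>x. poly p (1 / x)) has_real_derivative poly (pderiv p) (1 / x) * (- 1 / x^2)) (at x)"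
        using DERIV_chain'[OF 1 poly_DERIV] by (simp add: mult.commute)
      from DERIV_mult[OF this 2] show ?thesis
        using 3 by (simp add: flat_def field_simps power2_eq_square)
    qed
    then show ?thesis
      by (rule has_field_derivative_transform_within_open[where S = "{0<..}"])
        (use 3 in \<open>auto simp: flat_def\<close>)
  qed
qed

lemma smooth_flat: "smooth (flat p)"
  by (rule smooth_coinduct[of _ "range flat"]) (use flat_has_derivative in blast)+

text \<open>On (-1, 1) this is the standard bump exp (-2 / (1 - x^2)), as 1/(1 + x) + 1/(1 - x) =
  2/(1 - x^2).\<close>

definition bump :: "real \<Rightarrow> real" where
  "bump x = flat 1 (1 + x) * flat 1 (1 - x)"

lemma smooth_bump: "smooth bump"
  using smooth_mult[OF smooth_affine[OF smooth_flat, of 1 1 1] smooth_affine[OF smooth_flat, of 1 "-1" 1]]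
  unfolding bump_def by (simp add: add.commute)

lemma bump_nonneg: "bump x \<ge> 0"
  by (simp add: bump_def flat_def)

lemma bump_eq_0: "\<bar>x\<bar> > 1 \<Longrightarrow> bump x = 0"
  by (auto simp: bump_def flat_def)

lemma integrable_lborel_compact_support:
  fixes f :: "real \<Rightarrow> real"
  assumes "continuous_on UNIV f" "\<And>x. x \<notin> {a..b} \<Longrightarrow> f x = 0"
  shows "integrable lborel f"
proof -
  have "set_integrable lborel {a..b} f"
    by (rule borel_integrable_atLeastAtMost') (use assms(1) continuous_on_subset in blast)
  moreover have "(\<lambda>x. indicat_real {a..b} x *\<^sub>R f x) = f"
    using assms(2) by (fastforce simp: indicator_def)
  ultimately show ?thesis
    by (simp add: set_integrable_def)
qed

lemma integral_bump_pos: "(\<integral>x. bump x \<partial>lborel) > 0"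
proof -
  have int: "integrable lborel bump"
    by (rule integrable_lborel_compact_support[of _ "-1" 1])
      (auto intro!: smooth_continuous_on smooth_bump bump_eq_0)
  have "(\<integral>x. bump x \<partial>lborel) \<noteq> 0"
  proof
    assume "(\<integral>x. bump x \<partial>lborel) = 0"
    then have "AE x in lborel. bump x = 0"
      using integral_nonneg_eq_0_iff_AE[OF int] bump_nonneg by auto
    then have "AE x in lborel. x \<notin> {-1<..<1::real}"
      by eventually_elim (auto simp: bump_def flat_def)
    then have "{-1<..<1::real} \<in> null_sets lborel"
      by (subst AE_iff_null_sets) auto
    then have "emeasure lborel {-1<..<1::real} = 0"
      by blast
    then show False
      by simp
  qed
  moreover have "(\<integral>x. bump x \<partial>lborel) \<ge> 0"
    by (simp add: bump_nonneg)
  ultimately show ?thesis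
    by simp
qed

definition mollifier :: "real \<Rightarrow> real" where
  "mollifier x = (1 / (\<integral>x. bump x \<partial>lborel)) * bump x"

lemma smooth_mollifier: "smooth mollifier"
  unfolding mollifier_def by (rule smooth_cmult[OF smooth_bump])

lemma mollifier_nonneg: "mollifier x \<ge> 0"
  using integral_bump_pos by (simp add: mollifier_def bump_nonneg)

lemma mollifier_eq_0: "\<bar>x\<bar> > 1 \<Longrightarrow> mollifier x = 0"
  by (simp add: mollifier_def bump_eq_0)

lemma integrable_mollifier: "integrable lborel mollifier"
  by (rule integrable_lborel_compact_support[of _ "-1" 1])
    (auto intro!: smooth_continuous_on smooth_mollifier mollifier_eq_0)

lemma borel_measurable_mollifier [measurable]: "mollifier \<in> borel_measurable borel"
  by (rule borel_measurable_continuous_onI[OF smooth_continuous_on[OF smooth_mollifier]])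

lemma integral_mollifier: "(\<integral>x. mollifier x \<partial>lborel) = 1"
  using integral_bump_pos by (simp add: mollifier_def)

lemma nn_integral_mollifier: "(\<integral>\<^sup>+x. ennreal (mollifier x) \<partial>lborel) = 1"
  using nn_integral_eq_integral[OF integrable_mollifier] by (simp add: mollifier_nonneg integral_mollifier)

lemma mollifier_bounded: "\<exists>M>0. \<forall>x. mollifier x \<le> M"
proof -
  have "bounded (mollifier ` {-1..1})"
    by (intro compact_imp_bounded compact_continuous_image smooth_continuous_on smooth_mollifier compact_Icc)
  then obtain M where "M > 0" "\<forall>x\<in>{-1..1}. norm (mollifier x) \<le> M"
    unfolding bounded_pos by auto
  then have "mollifier x \<le> M" for x
    using mollifier_eq_0[of x] by (cases "\<bar>x\<bar> \<le> 1") (auto simp: abs_le_iff)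
  then show ?thesis
    using \<open>M > 0\<close> by blast
qed

subsection \<open>The Gagliardo energy\<close>

text \<open>Carries L^2 convergence over to L^1: the map a |-> a |a| keeps the sign and has absolute
  value a^2. For equal signs the right side is 2 |a - b| |a + b| and |a - b| <= |a + b|. For
  opposite signs it is 2 (a^2 + b^2); the case b = -a shows that the factor 2 cannot be
  lowered.\<close>

lemma square_diff_le_signed_squares: "(a - b)\<^sup>2 \<le> 2 * \<bar>a * \<bar>a\<bar> - b * \<bar>b\<bar>\<bar>" for a b :: real
proof -
  have *: "(a - b)\<^sup>2 \<le> 2 * \<bar>a * \<bar>a\<bar> - b * \<bar>b\<bar>\<bar>" if "a \<ge> b" for a b :: real
  proof -
    consider "b \<ge> 0" | "a \<le> 0" | "b < 0" "a > 0" by linarith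
    then show ?thesis
    proof cases
      case 1
      then have "(a - b) * (a - b) \<le> (a - b) * (a + b)"
        using that by (intro mult_left_mono) auto
      moreover have "(a - b) * (a + b) \<ge> 0"
        using that 1 by (intro mult_nonneg_nonneg) auto
      ultimately show ?thesis
        using that 1 by (simp add: power2_eq_square algebra_simps)
    next
      case 2
      then have "(a - b) * (a - b) \<le> (a - b) * (- a - b)"
        using that by (intro mult_left_mono) auto
      moreover have "(a - b) * (- a - b) \<ge> 0"
        using that 2 by (intro mult_nonneg_nonneg) auto
      ultimately show ?thesis
        using that 2 by (simp add: power2_eq_square algebra_simps)
    next
      case 3
      have "(a - b)\<^sup>2 \<le> 2 * (a * a + b * b)"
        using zero_le_power2[of "a + b"] by (simp add: power2_eq_square algebra_simps)
      also have "\<dots> = 2 * \<bar>a * \<bar>a\<bar> - b * \<bar>b\<bar>\<bar>"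
        using 3 by (simp add: abs_of_nonneg)
      finally show ?thesis .
    qed
  qed
  show ?thesis
    using *[of a b] *[of b a] by (cases "a \<ge> b") (auto simp: power2_commute abs_minus_commute)
qed

text \<open>Scheffe's lemma applied to the signed squares \<open>f n * \<bar>f n\<bar>\<close>.\<close>

lemma scheffe_square:
  fixes f :: "nat \<Rightarrow> 'a \<Rightarrow> real"
  assumes [measurable]: "\<And>n. f n \<in> borel_measurable M" "g \<in> borel_measurable M" "k \<in> borel_measurable M"
    and k: "\<And>x. k x \<ge> 0"
    and fin: "(\<integral>\<^sup>+x. ennreal ((g x)\<^sup>2 * k x) \<partial>M) < \<infinity>"
    and lim: "AE x in M. (\<lambda>n. f n x) \<longlonglongrightarrow> g x"
    and le: "\<And>n. (\<integral>\<^sup>+x. ennreal ((f n x)\<^sup>2 * k x) \<partial>M) \<le> (\<integral>\<^sup>+x. ennreal ((g x)\<^sup>2 * k x) \<partial>M)"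
  shows "(\<lambda>n. \<integral>\<^sup>+x. ennreal ((g x - f n x)\<^sup>2 * k x) \<partial>M) \<longlonglongrightarrow> 0"
proof -
  have norm_eq: "norm (a * \<bar>a\<bar> * k x) = a\<^sup>2 * k x" for a x
    using k[of x] by (simp add: abs_mult power2_eq_square)
  have nn_eq: "(\<integral>\<^sup>+x. ennreal (norm (h x * \<bar>h x\<bar> * k x)) \<partial>M) = (\<integral>\<^sup>+x. ennreal ((h x)\<^sup>2 * k x) \<partial>M)" for h
    by (intro nn_integral_cong) (simp only: norm_eq)
  have meas [measurable]: "(\<lambda>x. g x * \<bar>g x\<bar> * k x) \<in> borel_measurable M"
    "\<And>n. (\<lambda>x. f n x * \<bar>f n x\<bar> * k x) \<in> borel_measurable M"
    by measurable
  have "integrable M (\<lambda>x. g x * \<bar>g x\<bar> * k x)"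
    by (rule integrableI_bounded[OF meas(1)]) (unfold nn_eq, rule fin)
  moreover have "AE x in M. (\<lambda>n. f n x * \<bar>f n x\<bar> * k x) \<longlonglongrightarrow> g x * \<bar>g x\<bar> * k x"
    using lim by eventually_elim (intro tendsto_intros)
  \<comment> \<open>This form of Scheffe's lemma takes an upper bound on the norms instead of their
    convergence; the lower bound is Fatou's lemma.\<close>
  ultimately have "(\<lambda>n. \<integral>\<^sup>+x. norm (f n x * \<bar>f n x\<bar> * k x - g x * \<bar>g x\<bar> * k x) \<partial>M) \<longlonglongrightarrow> 0"
    by (rule Scheffe_lemma2[OF meas(2)]) (unfold nn_eq, rule le)
  from ennreal_tendsto_cmult[OF _ this, of 2]
  have lim2: "(\<lambda>n. 2 * (\<integral>\<^sup>+x. norm (f n x * \<bar>f n x\<bar> * k x - g x * \<bar>g x\<bar> * k x) \<partial>M)) \<longlonglongrightarrow> 0"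
    by simp
  have le2: "(\<integral>\<^sup>+x. ennreal ((g x - f n x)\<^sup>2 * k x) \<partial>M)
      \<le> 2 * (\<integral>\<^sup>+x. norm (f n x * \<bar>f n x\<bar> * k x - g x * \<bar>g x\<bar> * k x) \<partial>M)" for n
  proof -
    have "(g x - f n x)\<^sup>2 * k x \<le> 2 * norm (f n x * \<bar>f n x\<bar> * k x - g x * \<bar>g x\<bar> * k x)" for x
    proof -
      have "(g x - f n x)\<^sup>2 * k x \<le> 2 * \<bar>f n x * \<bar>f n x\<bar> - g x * \<bar>g x\<bar>\<bar> * k x"
        unfolding power2_commute[of "g x"] by (rule mult_right_mono[OF square_diff_le_signed_squares k])
      also have "\<dots> = 2 * norm (f n x * \<bar>f n x\<bar> * k x - g x * \<bar>g x\<bar> * k x)"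
        unfolding left_diff_distrib[symmetric] real_norm_def abs_mult[of _ "k x"] abs_of_nonneg[OF k]
        by (rule mult.assoc)
      finally show ?thesis .
    qed
    then have "(\<integral>\<^sup>+x. ennreal ((g x - f n x)\<^sup>2 * k x) \<partial>M)
      \<le> (\<integral>\<^sup>+x. ennreal 2 * norm (f n x * \<bar>f n x\<bar> * k x - g x * \<bar>g x\<bar> * k x) \<partial>M)"
      by (intro nn_integral_mono) (subst ennreal_mult'[symmetric], simp, rule ennreal_leI)
    then show ?thesis
      by (simp add: nn_integral_cmult)
  qed
  show ?thesis
    by (rule tendsto_sandwich[OF always_eventually always_eventually tendsto_const lim2])
      (simp_all only: le2 zero_le simp_thms)
qed

text \<open>Jensen's inequality for squares about an arbitrary centre c. The right side may be
  infinite, so the square need not be integrable. Otherwise integrate the tangent bound (f - c)^2 >=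
  2 a (f - c) - a^2, taken at the mean deviation a, where the right side integrates to a^2.\<close>

lemma weighted_jensen:
  fixes k f :: "'a \<Rightarrow> real"
  assumes k: "\<And>x. k x \<ge> 0" "integrable M k" "(\<integral>x. k x \<partial>M) = 1"
    and [measurable]: "f \<in> borel_measurable M"
    and f: "integrable M (\<lambda>x. k x * f x)"
  shows "ennreal (((\<integral>x. k x * f x \<partial>M) - c)\<^sup>2) \<le> (\<integral>\<^sup>+x. ennreal (k x * (f x - c)\<^sup>2) \<partial>M)"
proof -
  note [measurable] = borel_measurable_integrable[OF k(2)]
  define a where "a = (\<integral>x. k x * f x \<partial>M) - c"
  show ?thesis
  proof (cases "(\<integral>\<^sup>+x. ennreal (k x * (f x - c)\<^sup>2) \<partial>M) < \<infinity>")
    case True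
    then have int: "integrable M (\<lambda>x. k x * (f x - c)\<^sup>2)"
      by (intro integrableI_bounded) (simp_all add: k abs_mult)
    have "k x * f x * (2 * a) - k x * (2 * a * c + a\<^sup>2) \<le> k x * (f x - c)\<^sup>2" for x
    proof -
      have "f x * (2 * a) - (2 * a * c + a\<^sup>2) \<le> (f x - c)\<^sup>2"
        using zero_le_power2[of "f x - c - a"] by (simp add: power2_eq_square algebra_simps)
      from mult_left_mono[OF this k(1)[of x]] show ?thesis
        by (simp add: right_diff_distrib mult.assoc)
    qed
    then have "(\<integral>x. k x * f x * (2 * a) - k x * (2 * a * c + a\<^sup>2) \<partial>M) \<le> (\<integral>x. k x * (f x - c)\<^sup>2 \<partial>M)"
      by (intro integral_mono) (use f k int in auto)
    also have "(\<integral>x. k x * f x * (2 * a) - k x * (2 * a * c + a\<^sup>2) \<partial>M)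
        = (\<integral>x. k x * f x \<partial>M) * (2 * a) - (2 * a * c + a\<^sup>2)"
      using f k by simp
    also have "\<dots> = a\<^sup>2"
      by (simp add: a_def power2_eq_square algebra_simps)
    finally show ?thesis
      by (subst nn_integral_eq_integral[OF int]) (auto simp: k a_def intro!: ennreal_leI)
  qed (simp add: not_less top_unique)
qed

text \<open>The energy up to the positive factor \<open>kernel_const \<beta> / 2\<close>, written as
  an iterated integral so that substitutions can be made in one variable at a time.\<close>

definition gagliardo :: "real \<Rightarrow> (real \<Rightarrow> real) \<Rightarrow> ennreal" where
  "gagliardo \<beta> u =
     (\<integral>\<^sup>+y. \<integral>\<^sup>+y'. ennreal ((u y' - u y)\<^sup>2 * \<bar>y' - y\<bar> powr (- 1 - \<beta>)) \<partial>lborel \<partial>lborel)"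

lemma gagliardo_pair:
  assumes [measurable]: "u \<in> borel_measurable borel"
  shows "gagliardo \<beta> u =
    (\<integral>\<^sup>+(y, y'). ennreal ((u y' - u y)\<^sup>2 * \<bar>y' - y\<bar> powr (- 1 - \<beta>)) \<partial>(lborel \<Otimes>\<^sub>M lborel))"
  unfolding gagliardo_def by (subst lborel.nn_integral_fst[symmetric]) auto

lemma kernel_const_pos:
  assumes "0 < \<beta>" "\<beta> < 2"
  shows "kernel_const \<beta> > 0"
proof -
  \<comment> \<open>The number -\<beta>/2 lies strictly between -1 and 0 and so misses the poles. At
    a pole \<open>Gamma\<close> is 0 by convention, and division by zero would turn the constant
    into 0.\<close>
  have "- \<beta> / 2 \<notin> \<int>\<^sub>\<le>\<^sub>0"
  proof
    assume "- \<beta> / 2 \<in> \<int>\<^sub>\<le>\<^sub>0"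
    then obtain n :: int where "- \<beta> / 2 = of_int n"
      by (auto elim!: nonpos_Ints_cases)
    then have "real_of_int (- 1) < real_of_int n" "real_of_int n < real_of_int 0"
      using assms by auto
    then show False
      unfolding of_int_less_iff by simp
  qed
  then have "Gamma (- \<beta> / 2) \<noteq> 0"
    by (simp add: Gamma_eq_zero_iff)
  moreover have "Gamma ((1 + \<beta>) / 2) > 0"
    using assms by (intro Gamma_real_pos) auto
  ultimately show ?thesis
    unfolding kernel_const_def by (intro divide_pos_pos mult_pos_pos) auto
qed

lemma energy_eq_gagliardo:
  assumes [measurable]: "u \<in> borel_measurable borel" and "0 < \<beta>" "\<beta> < 2"
  shows "energy \<beta> u = ennreal (kernel_const \<beta> / 2) * gagliardo \<beta> u"
proof -
  have c: "kernel_const \<beta> \<ge> 0"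
    using kernel_const_pos[OF assms(2,3)] by simp
  have "energy \<beta> u = (1 / 2) * (\<integral>\<^sup>+p. ennreal (kernel_const \<beta>) *
      (case p of (y, y') \<Rightarrow> ennreal ((u y' - u y)\<^sup>2 * \<bar>y' - y\<bar> powr (- 1 - \<beta>))) \<partial>(lborel \<Otimes>\<^sub>M lborel))"
    unfolding energy_def jump_kernel_def
    by (intro arg_cong[of _ _ "\<lambda>a. (1 / 2) * a"] nn_integral_cong)
      (auto simp: ennreal_mult'[symmetric] c algebra_simps)
  also have "\<dots> = (1 / 2) * (ennreal (kernel_const \<beta>) * gagliardo \<beta> u)"
    by (subst nn_integral_cmult) (auto simp: gagliardo_pair)
  also have "(1 / 2 :: ennreal) = ennreal (1 / 2)"
    by (metis divide_ennreal ennreal_1 ennreal_numeral zero_less_numeral zero_le_one)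
  also have "ennreal (1 / 2) * (ennreal (kernel_const \<beta>) * gagliardo \<beta> u)
      = ennreal (kernel_const \<beta> / 2) * gagliardo \<beta> u"
    by (subst mult.assoc[symmetric], subst ennreal_mult[symmetric]) (auto simp: c)
  finally show ?thesis .
qed

lemma sobolev_iff:
  assumes "0 < \<beta>" "\<beta> < 2"
  shows "u \<in> sobolev \<beta> \<longleftrightarrow> u \<in> borel_measurable borel \<and> integrable lborel (\<lambda>x. (u x)\<^sup>2) \<and>
    gagliardo \<beta> u < \<infinity>"
  using kernel_const_pos[OF assms] energy_eq_gagliardo[OF _ assms, of u]
  by (auto simp: sobolev_def ennreal_mult_less_top)

lemma sobolev_norm_bounds:
  assumes "0 < \<beta>" "\<beta> < 2" "u \<in> sobolev \<beta>"
  shows "(\<integral>x. (u x)\<^sup>2 \<partial>lborel) \<le> (sobolev_norm \<beta> u)\<^sup>2"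
    and "enn2real (gagliardo \<beta> u) \<le> 2 / kernel_const \<beta> * (sobolev_norm \<beta> u)\<^sup>2"
proof -
  have c: "kernel_const \<beta> > 0"
    using kernel_const_pos[OF assms(1,2)] .
  have sq: "(sobolev_norm \<beta> u)\<^sup>2 = (\<integral>x. (u x)\<^sup>2 \<partial>lborel) + enn2real (energy \<beta> u)"
    unfolding sobolev_norm_def by (subst real_sqrt_pow2) auto
  have "enn2real (energy \<beta> u) = kernel_const \<beta> / 2 * enn2real (gagliardo \<beta> u)"
    using assms c by (subst energy_eq_gagliardo) (auto simp: sobolev_def enn2real_mult)
  moreover have "(\<integral>x. (u x)\<^sup>2 \<partial>lborel) \<ge> 0"
    by simp
  ultimately show "(\<integral>x. (u x)\<^sup>2 \<partial>lborel) \<le> (sobolev_norm \<beta> u)\<^sup>2"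
    "enn2real (gagliardo \<beta> u) \<le> 2 / kernel_const \<beta> * (sobolev_norm \<beta> u)\<^sup>2"
    using c sq by (simp_all add: field_simps)
qed

lemma sobolev_norm_tendsto_0:
  assumes "0 < \<beta>" "\<beta> < 2" and [measurable]: "\<And>n. u n \<in> borel_measurable borel"
    and L2: "(\<lambda>n. \<integral>\<^sup>+x. ennreal ((u n x)\<^sup>2) \<partial>lborel) \<longlonglongrightarrow> 0"
    and gag: "(\<lambda>n. gagliardo \<beta> (u n)) \<longlonglongrightarrow> 0"
  shows "(\<lambda>n. sobolev_norm \<beta> (u n)) \<longlonglongrightarrow> 0"
proof -
  have "(\<lambda>n. enn2real (\<integral>\<^sup>+x. ennreal ((u n x)\<^sup>2) \<partial>lborel)) \<longlonglongrightarrow> enn2real 0"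
    using tendsto_enn2real[OF L2[folded ennreal_0]] by simp
  then have 1: "(\<lambda>n. \<integral>x. (u n x)\<^sup>2 \<partial>lborel) \<longlonglongrightarrow> 0"
    by (simp add: integral_eq_nn_integral)
  have "(\<lambda>n. ennreal (kernel_const \<beta> / 2) * gagliardo \<beta> (u n)) \<longlonglongrightarrow> ennreal (kernel_const \<beta> / 2) * 0"
    by (intro ennreal_tendsto_cmult gag) auto
  then have "(\<lambda>n. energy \<beta> (u n)) \<longlonglongrightarrow> ennreal 0"
    by (simp add: energy_eq_gagliardo[OF _ assms(1,2)])
  then have 2: "(\<lambda>n. enn2real (energy \<beta> (u n))) \<longlonglongrightarrow> 0"
    by (intro tendsto_enn2real) auto
  show ?thesis
    unfolding sobolev_norm_def
    using tendsto_real_sqrt[OF tendsto_add[OF 1 2]] by simp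
qed

lemma nn_integral_square_finite:
  assumes "integrable lborel (\<lambda>x. (u x)\<^sup>2)"
  shows "(\<integral>\<^sup>+x. ennreal ((u x)\<^sup>2) \<partial>lborel) < \<infinity>"
  using assms by (subst nn_integral_eq_integral) auto

text \<open>Approximants that converge almost everywhere and do not exceed u in L^2 norm or energy
  converge in norm, with no rate required. Scheffe's lemma is applied twice: on the line with weight
  1, and on the plane to the increments with the kernel as weight.\<close>

lemma sobolev_norm_approximation:
  assumes "0 < \<beta>" "\<beta> < 2" and u: "u \<in> sobolev \<beta>"
    and [measurable]: "\<And>n. w n \<in> borel_measurable borel"
    and lim: "AE x in lborel. (\<lambda>n. w n x) \<longlonglongrightarrow> u x"
    and L2: "\<And>n. (\<integral>\<^sup>+x. ennreal ((w n x)\<^sup>2) \<partial>lborel) \<le> (\<integral>\<^sup>+x. ennreal ((u x)\<^sup>2) \<partial>lborel)"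
    and gag: "\<And>n. gagliardo \<beta> (w n) \<le> gagliardo \<beta> u"
  shows "(\<lambda>n. sobolev_norm \<beta> (\<lambda>x. u x - w n x)) \<longlonglongrightarrow> 0"
proof (rule sobolev_norm_tendsto_0[OF assms(1,2)])
  have [measurable]: "u \<in> borel_measurable borel" and int: "integrable lborel (\<lambda>x. (u x)\<^sup>2)"
    and fin: "gagliardo \<beta> u < \<infinity>"
    using u sobolev_iff[OF assms(1,2)] by auto
  show "(\<lambda>x. u x - w n x) \<in> borel_measurable borel" for n
    by measurable
  show "(\<lambda>n. \<integral>\<^sup>+x. ennreal ((u x - w n x)\<^sup>2) \<partial>lborel) \<longlonglongrightarrow> 0"
    using scheffe_square[where M = lborel and k = "\<lambda>_. 1" and f = w and g = u] lim L2
      nn_integral_square_finite[OF int] by simp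
  let ?d = "\<lambda>v (y, y'). v y' - v y :: real" and ?k = "\<lambda>(y, y'). \<bar>y' - y\<bar> powr (- 1 - \<beta>)"
  have gag_eq: "gagliardo \<beta> v = (\<integral>\<^sup>+p. ennreal ((?d v p)\<^sup>2 * ?k p) \<partial>(lborel \<Otimes>\<^sub>M lborel))"
    if [measurable]: "v \<in> borel_measurable borel" for v
    by (auto simp: gagliardo_pair intro!: nn_integral_cong)
  \<comment> \<open>The exceptional pairs have a coordinate in a null set of the line, so they form
    a null set of the plane.\<close>
  have AE_pair: "AE p in lborel \<Otimes>\<^sub>M lborel. (\<lambda>n. ?d (w n) p) \<longlonglongrightarrow> ?d u p"
  proof (rule lborel_pair.AE_pair_measure)
    show "{p \<in> space (lborel \<Otimes>\<^sub>M lborel). (\<lambda>n. ?d (w n) p) \<longlonglongrightarrow> ?d u p} \<in> sets (lborel \<Otimes>\<^sub>M lborel)"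
      by measurable
    show "AE y in lborel. AE y' in lborel. (\<lambda>n. ?d (w n) (y, y')) \<longlonglongrightarrow> ?d u (y, y')"
      using lim
    proof eventually_elim
      case (elim y)
      show ?case
        using lim by eventually_elim (use elim in \<open>auto intro!: tendsto_intros\<close>)
    qed
  qed
  have "(\<lambda>n. \<integral>\<^sup>+p. ennreal ((?d u p - ?d (w n) p)\<^sup>2 * ?k p) \<partial>(lborel \<Otimes>\<^sub>M lborel)) \<longlonglongrightarrow> 0"
    by (rule scheffe_square) (use gag fin AE_pair in \<open>auto simp: gag_eq\<close>)
  moreover have "gagliardo \<beta> (\<lambda>x. u x - w n x) =
      (\<integral>\<^sup>+p. ennreal ((?d u p - ?d (w n) p)\<^sup>2 * ?k p) \<partial>(lborel \<Otimes>\<^sub>M lborel))" for n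
    by (subst gag_eq) (auto simp: split_beta algebra_simps intro!: nn_integral_cong)
  ultimately show "(\<lambda>n. gagliardo \<beta> (\<lambda>x. u x - w n x)) \<longlonglongrightarrow> 0"
    by simp
qed

subsection \<open>Mollification\<close>

text \<open>In this form the weight is one fixed probability density, independent of \<delta> and x,
  as Jensen's inequality wants it; \<delta> and x only move the argument of u.\<close>

definition mollify :: "real \<Rightarrow> (real \<Rightarrow> real) \<Rightarrow> real \<Rightarrow> real" where
  "mollify \<delta> u x = (\<integral>s. mollifier s * u (x - \<delta> * s) \<partial>lborel)"

lemma nn_integral_translate:
  fixes h :: real
  assumes [measurable]: "f \<in> borel_measurable borel"
  shows "(\<integral>\<^sup>+x. f (x - h) \<partial>lborel) = (\<integral>\<^sup>+x. f x \<partial>lborel)"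
  using nn_integral_real_affine[OF assms, of 1 "- h"] by simp

lemma nn_integral_reflect_scale:
  fixes \<delta> x :: real
  assumes [measurable]: "f \<in> borel_measurable borel" and "\<delta> > 0"
  shows "(\<integral>\<^sup>+s. f (x - \<delta> * s) \<partial>lborel) = ennreal (1 / \<delta>) * (\<integral>\<^sup>+y. f y \<partial>lborel)"
proof -
  have "(\<integral>\<^sup>+y. f y \<partial>lborel) = ennreal \<delta> * (\<integral>\<^sup>+s. f (x - \<delta> * s) \<partial>lborel)"
    using nn_integral_real_affine[OF assms(1), of "- \<delta>" x] \<open>\<delta> > 0\<close> by simp
  then have "ennreal (1 / \<delta>) * (\<integral>\<^sup>+y. f y \<partial>lborel) = ennreal (1 / \<delta> * \<delta>) * (\<integral>\<^sup>+s. f (x - \<delta> * s) \<partial>lborel)"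
    using \<open>\<delta> > 0\<close> by (simp only: ennreal_mult mult.assoc zero_le_divide_1_iff less_imp_le)
  then show ?thesis
    using \<open>\<delta> > 0\<close> by simp
qed

text \<open>With m the mollifier and M a bound for it, |m u| <= m^2 + u^2 and m^2 <= M m, so square
  integrability of u is enough.\<close>

lemma integrable_mollify:
  assumes [measurable]: "u \<in> borel_measurable borel"
    and int: "integrable lborel (\<lambda>x. (u x)\<^sup>2)" and "\<delta> > 0"
  shows "integrable lborel (\<lambda>s. mollifier s * u (x - \<delta> * s))"
proof -
  obtain M where M: "M > 0" "\<And>x. mollifier x \<le> M"
    using mollifier_bounded by blast
  have "integrable lborel (\<lambda>s. M * mollifier s + (u (x + (- \<delta>) * s))\<^sup>2)"
    using \<open>\<delta> > 0\<close> by (intro Bochner_Integration.integrable_add integrable_mult_right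
        integrable_mollifier lborel_integrable_real_affine[OF int]) auto
  then show ?thesis
  proof (rule Bochner_Integration.integrable_bound)
    show "AE s in lborel. norm (mollifier s * u (x - \<delta> * s)) \<le> norm (M * mollifier s + (u (x + (- \<delta>) * s))\<^sup>2)"
    proof (intro AE_I2)
      fix s
      have "0 \<le> (mollifier s)\<^sup>2 + (u (x - \<delta> * s))\<^sup>2" by simp
      moreover have "2 * (mollifier s * \<bar>u (x - \<delta> * s)\<bar>) \<le> (mollifier s)\<^sup>2 + (u (x - \<delta> * s))\<^sup>2"
        using zero_le_power2[of "mollifier s - \<bar>u (x - \<delta> * s)\<bar>"]
        by (simp add: power2_eq_square algebra_simps)
      ultimately have "mollifier s * \<bar>u (x - \<delta> * s)\<bar> \<le> (mollifier s)\<^sup>2 + (u (x - \<delta> * s))\<^sup>2"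
        by linarith
      also have "(mollifier s)\<^sup>2 \<le> M * mollifier s"
        unfolding power2_eq_square by (intro mult_right_mono M mollifier_nonneg)
      finally show "norm (mollifier s * u (x - \<delta> * s)) \<le> norm (M * mollifier s + (u (x + (- \<delta>) * s))\<^sup>2)"
        by (simp add: abs_mult mollifier_nonneg)
    qed
  qed measurable
qed

lemma borel_measurable_mollify [measurable]:
  assumes [measurable]: "u \<in> borel_measurable borel"
  shows "mollify \<delta> u \<in> borel_measurable borel"
  unfolding mollify_def by measurable

lemma mollify_jensen:
  assumes [measurable]: "u \<in> borel_measurable borel"
    and int: "integrable lborel (\<lambda>x. (u x)\<^sup>2)" and "\<delta> > 0"
  shows "ennreal ((mollify \<delta> u x - c)\<^sup>2) \<le> (\<integral>\<^sup>+s. ennreal (mollifier s * (u (x - \<delta> * s) - c)\<^sup>2) \<partial>lborel)"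
  unfolding mollify_def
  by (rule weighted_jensen)
    (auto simp: mollifier_nonneg integrable_mollifier integral_mollifier intro: integrable_mollify assms)

lemma nn_integral_mollify_square_le:
  assumes [measurable]: "u \<in> borel_measurable borel"
    and int: "integrable lborel (\<lambda>x. (u x)\<^sup>2)" and "\<delta> > 0"
  shows "(\<integral>\<^sup>+x. ennreal ((mollify \<delta> u x)\<^sup>2) \<partial>lborel) \<le> (\<integral>\<^sup>+x. ennreal ((u x)\<^sup>2) \<partial>lborel)"
proof -
  have "(\<integral>\<^sup>+x. ennreal ((mollify \<delta> u x)\<^sup>2) \<partial>lborel)
      \<le> (\<integral>\<^sup>+x. \<integral>\<^sup>+s. ennreal (mollifier s) * ennreal ((u (x - \<delta> * s))\<^sup>2) \<partial>lborel \<partial>lborel)"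
    using mollify_jensen[OF assms, of _ 0]
    by (intro nn_integral_mono) (simp add: ennreal_mult mollifier_nonneg)
  also have "\<dots> = (\<integral>\<^sup>+s. \<integral>\<^sup>+x. ennreal (mollifier s) * ennreal ((u (x - \<delta> * s))\<^sup>2) \<partial>lborel \<partial>lborel)"
    by (rule lborel_pair.Fubini') measurable
  also have "\<dots> = (\<integral>\<^sup>+s. ennreal (mollifier s) * (\<integral>\<^sup>+x. ennreal ((u x)\<^sup>2) \<partial>lborel) \<partial>lborel)"
    using nn_integral_translate[of "\<lambda>x. ennreal ((u x)\<^sup>2)"]
    by (intro nn_integral_cong) (simp add: nn_integral_cmult)
  also have "\<dots> = (\<integral>\<^sup>+x. ennreal ((u x)\<^sup>2) \<partial>lborel)"
    by (simp add: nn_integral_multc nn_integral_mollifier)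
  finally show ?thesis .
qed

lemma gagliardo_translate:
  assumes [measurable]: "u \<in> borel_measurable borel"
  shows "gagliardo \<beta> (\<lambda>x. u (x - h)) = gagliardo \<beta> u"
proof -
  have "gagliardo \<beta> (\<lambda>x. u (x - h)) = (\<integral>\<^sup>+y. (\<lambda>y. \<integral>\<^sup>+y'. ennreal ((u (y' - h) - u y)\<^sup>2 *
      \<bar>(y' - h) - y\<bar> powr (- 1 - \<beta>)) \<partial>lborel) (y - h) \<partial>lborel)"
    by (simp add: gagliardo_def algebra_simps)
  also have "\<dots> = (\<integral>\<^sup>+y. \<integral>\<^sup>+y'. ennreal ((u (y' - h) - u y)\<^sup>2 *
      \<bar>(y' - h) - y\<bar> powr (- 1 - \<beta>)) \<partial>lborel \<partial>lborel)"
    by (rule nn_integral_translate) measurable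
  also have "\<dots> = gagliardo \<beta> u"
    unfolding gagliardo_def by (intro nn_integral_cong nn_integral_translate) measurable
  finally show ?thesis .
qed

text \<open>For each s, the shift by \<delta> s moves both points of an increment and leaves their
  distance alone. Jensen's inequality under the unchanged kernel leaves an average of the energies
  of translates of u, which all equal the energy of u.\<close>

lemma gagliardo_mollify_le:
  assumes [measurable]: "u \<in> borel_measurable borel"
    and int: "integrable lborel (\<lambda>x. (u x)\<^sup>2)" and "\<delta> > 0"
  shows "gagliardo \<beta> (mollify \<delta> u) \<le> gagliardo \<beta> u"
proof -
  let ?F = "\<lambda>y y' s. ennreal (mollifier s) * ennreal ((u (y' - \<delta> * s) - u (y - \<delta> * s))\<^sup>2 * \<bar>y' - y\<bar> powr (- 1 - \<beta>))"
  have "ennreal ((mollify \<delta> u y' - mollify \<delta> u y)\<^sup>2 * \<bar>y' - y\<bar> powr (- 1 - \<beta>)) \<le> (\<integral>\<^sup>+s. ?F y y' s \<partial>lborel)" for y y'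
  proof -
    have int': "integrable lborel (\<lambda>s. mollifier s * u (x - \<delta> * s))" for x
      by (rule integrable_mollify[OF assms])
    \<comment> \<open>The trailing \<open>- 0\<close> is the centre c = 0 of
      \<open>weighted_jensen\<close>.\<close>
    have "mollify \<delta> u y' - mollify \<delta> u y =
        (\<integral>s. mollifier s * (u (y' - \<delta> * s) - u (y - \<delta> * s)) \<partial>lborel) - 0"
      unfolding mollify_def by (simp add: right_diff_distrib Bochner_Integration.integral_diff int')
    moreover have "ennreal (((\<integral>s. mollifier s * (u (y' - \<delta> * s) - u (y - \<delta> * s)) \<partial>lborel) - 0)\<^sup>2)
        \<le> (\<integral>\<^sup>+s. ennreal (mollifier s * (u (y' - \<delta> * s) - u (y - \<delta> * s) - 0)\<^sup>2) \<partial>lborel)"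
      by (rule weighted_jensen)
        (auto simp: mollifier_nonneg integrable_mollifier integral_mollifier right_diff_distrib
          intro!: Bochner_Integration.integrable_diff int')
    ultimately have "ennreal ((mollify \<delta> u y' - mollify \<delta> u y)\<^sup>2) \<le>
        (\<integral>\<^sup>+s. ennreal (mollifier s * (u (y' - \<delta> * s) - u (y - \<delta> * s))\<^sup>2) \<partial>lborel)"
      by simp
    then have "ennreal ((mollify \<delta> u y' - mollify \<delta> u y)\<^sup>2) * ennreal (\<bar>y' - y\<bar> powr (- 1 - \<beta>)) \<le>
        (\<integral>\<^sup>+s. ennreal (mollifier s * (u (y' - \<delta> * s) - u (y - \<delta> * s))\<^sup>2) \<partial>lborel) * ennreal (\<bar>y' - y\<bar> powr (- 1 - \<beta>))"
      by (rule mult_right_mono) simp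
    also have "\<dots> = (\<integral>\<^sup>+s. ?F y y' s \<partial>lborel)"
      by (subst nn_integral_multc[symmetric])
        (auto simp: ennreal_mult mollifier_nonneg mult.assoc intro!: nn_integral_cong)
    finally show ?thesis
      by (simp add: ennreal_mult)
  qed
  then have "gagliardo \<beta> (mollify \<delta> u) \<le> (\<integral>\<^sup>+y. \<integral>\<^sup>+y'. \<integral>\<^sup>+s. ?F y y' s \<partial>lborel \<partial>lborel \<partial>lborel)"
    unfolding gagliardo_def by (intro nn_integral_mono)
  also have "\<dots> = (\<integral>\<^sup>+y. \<integral>\<^sup>+s. \<integral>\<^sup>+y'. ?F y y' s \<partial>lborel \<partial>lborel \<partial>lborel)"
    by (intro nn_integral_cong lborel_pair.Fubini') measurable
  also have "\<dots> = (\<integral>\<^sup>+s. \<integral>\<^sup>+y. \<integral>\<^sup>+y'. ?F y y' s \<partial>lborel \<partial>lborel \<partial>lborel)"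
    by (intro lborel_pair.Fubini') measurable
  also have "\<dots> = (\<integral>\<^sup>+s. ennreal (mollifier s) * gagliardo \<beta> (\<lambda>x. u (x - \<delta> * s)) \<partial>lborel)"
    unfolding gagliardo_def by (intro nn_integral_cong) (simp add: nn_integral_cmult)
  also have "\<dots> = gagliardo \<beta> u"
    by (simp add: gagliardo_translate nn_integral_multc nn_integral_mollifier)
  finally show ?thesis .
qed

section \<open>Mollification errors bounded by the energy\<close>

lemma powr_kernel_ge:
  fixes z :: real
  assumes "\<bar>z\<bar> \<le> R" "z \<noteq> 0" "\<beta> \<ge> 0"
  shows "1 \<le> R powr (1 + \<beta>) * \<bar>z\<bar> powr (- 1 - \<beta>)"
proof -
  have "1 = \<bar>z\<bar> powr (1 + \<beta>) * \<bar>z\<bar> powr (- 1 - \<beta>)"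
    using assms powr_minus[of "\<bar>z\<bar>" "1 + \<beta>"] by simp
  also have "\<dots> \<le> R powr (1 + \<beta>) * \<bar>z\<bar> powr (- 1 - \<beta>)"
    using assms by (intro mult_right_mono powr_mono2) auto
  finally show ?thesis .
qed

text \<open>Inserts the kernel into an average over nearby points. The diagonal needs its own case:
  there \<open>0 powr a = 0\<close> makes the kernel vanish, but so does the increment.\<close>

lemma square_le_powr_kernel:
  fixes u :: "real \<Rightarrow> real"
  assumes "\<bar>y' - y\<bar> \<le> R" "\<beta> \<ge> 0"
  shows "(u y' - u y)\<^sup>2 \<le> R powr (1 + \<beta>) * ((u y' - u y)\<^sup>2 * \<bar>y' - y\<bar> powr (- 1 - \<beta>))"
proof (cases "y = y'")
  case False
  then have "1 \<le> R powr (1 + \<beta>) * \<bar>y' - y\<bar> powr (- 1 - \<beta>)"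
    using assms by (intro powr_kernel_ge) auto
  from mult_left_mono[OF this zero_le_power2[of "u y' - u y"]] show ?thesis
    by (simp add: mult_ac)
qed simp

text \<open>Jensen's inequality is used twice, first for the average at scale r about the value
  \<open>mollify q u x\<close>, then for the average at scale q about each value u (x - r s). The
  points x - r s and x - q t are at most r + q <= 2 r apart. Bounding both mollifiers gives M^2, and
  the two substitutions give 1 / (r q).\<close>

lemma mollify_diff_le:
  assumes [measurable]: "u \<in> borel_measurable borel"
    and int: "integrable lborel (\<lambda>x. (u x)\<^sup>2)" and "0 < q" "q \<le> r" "\<beta> \<ge> 0"
    and M: "\<And>x. mollifier x \<le> M"
  shows "ennreal ((mollify r u x - mollify q u x)\<^sup>2)
    \<le> ennreal (M\<^sup>2 * (2 * r) powr (1 + \<beta>) / (r * q)) * gagliardo \<beta> u"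
proof -
  have r: "r > 0" using assms by simp
  have M0: "M \<ge> 0"
    using M[of 0] mollifier_nonneg[of 0] by linarith
  let ?g = "\<lambda>y y'. ennreal ((u y' - u y)\<^sup>2 * \<bar>y' - y\<bar> powr (- 1 - \<beta>))"
  let ?C = "ennreal (M\<^sup>2 * (2 * r) powr (1 + \<beta>))"
  have "ennreal ((mollify r u x - mollify q u x)\<^sup>2)
      \<le> (\<integral>\<^sup>+s. ennreal (mollifier s) * ennreal ((mollify q u x - u (x - r * s))\<^sup>2) \<partial>lborel)"
    using mollify_jensen[OF assms(1,2) r, of x "mollify q u x"]
    by (simp add: ennreal_mult mollifier_nonneg power2_commute)
  also have "\<dots> \<le> (\<integral>\<^sup>+s. ennreal (mollifier s) *
      (\<integral>\<^sup>+t. ennreal (mollifier t * (u (x - q * t) - u (x - r * s))\<^sup>2) \<partial>lborel) \<partial>lborel)"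
    by (intro nn_integral_mono mult_left_mono mollify_jensen assms) auto
  also have "\<dots> = (\<integral>\<^sup>+s. \<integral>\<^sup>+t. ennreal (mollifier s * (mollifier t * (u (x - q * t) - u (x - r * s))\<^sup>2)) \<partial>lborel \<partial>lborel)"
    by (intro nn_integral_cong) (simp add: nn_integral_cmult[symmetric] ennreal_mult mollifier_nonneg)
  also have "\<dots> \<le> (\<integral>\<^sup>+s. \<integral>\<^sup>+t. ?C * ?g (x - r * s) (x - q * t) \<partial>lborel \<partial>lborel)"
  proof (intro nn_integral_mono)
    fix s t :: real
    let ?y = "x - r * s" and ?y' = "x - q * t"
    have "mollifier s * (mollifier t * (u ?y' - u ?y)\<^sup>2)
        \<le> M\<^sup>2 * (2 * r) powr (1 + \<beta>) * ((u ?y' - u ?y)\<^sup>2 * \<bar>?y' - ?y\<bar> powr (- 1 - \<beta>))"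
    proof (cases "\<bar>s\<bar> \<le> 1 \<and> \<bar>t\<bar> \<le> 1")
      case True
      have "\<bar>?y' - ?y\<bar> \<le> r * \<bar>s\<bar> + q * \<bar>t\<bar>"
        using abs_triangle_ineq4[of "r * s" "q * t"] r \<open>0 < q\<close> by (simp add: abs_mult)
      also have "\<dots> \<le> r * 1 + r * 1"
        using True assms r by (intro add_mono mult_mono) auto
      finally have le: "\<bar>?y' - ?y\<bar> \<le> 2 * r"
        by simp
      have "mollifier s * (mollifier t * (u ?y' - u ?y)\<^sup>2) \<le> M * (M * (u ?y' - u ?y)\<^sup>2)"
        by (intro mult_mono M mollifier_nonneg M0 mult_nonneg_nonneg) auto
      also have "\<dots> = M\<^sup>2 * (u ?y' - u ?y)\<^sup>2"
        by (simp add: power2_eq_square)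
      also have "\<dots> \<le> M\<^sup>2 * ((2 * r) powr (1 + \<beta>) * ((u ?y' - u ?y)\<^sup>2 * \<bar>?y' - ?y\<bar> powr (- 1 - \<beta>)))"
        by (intro mult_left_mono square_le_powr_kernel le assms) auto
      finally show ?thesis
        by (simp add: mult.assoc)
    next
      case False
      then have "mollifier s * (mollifier t * (u ?y' - u ?y)\<^sup>2) = 0"
        using mollifier_eq_0[of s] mollifier_eq_0[of t] by auto
      also have "0 \<le> M\<^sup>2 * (2 * r) powr (1 + \<beta>) * ((u ?y' - u ?y)\<^sup>2 * \<bar>?y' - ?y\<bar> powr (- 1 - \<beta>))"
        by (intro mult_nonneg_nonneg) auto
      finally show ?thesis .
    qed
    then show "ennreal (mollifier s * (mollifier t * (u ?y' - u ?y)\<^sup>2)) \<le> ?C * ?g ?y ?y'"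
      by (subst ennreal_mult'[symmetric]) (auto intro!: ennreal_leI)
  qed
  \<comment> \<open>The inner substitution is y' = x - q t; the outer one, y = x - r s, follows.
    Both points now range over the whole line, which removes x from the bound.\<close>
  also have "\<dots> = (\<integral>\<^sup>+s. (\<lambda>y. ?C * (ennreal (1 / q) * (\<integral>\<^sup>+y'. ?g y y' \<partial>lborel))) (x - r * s) \<partial>lborel)"
  proof (intro nn_integral_cong)
    fix s
    show "(\<integral>\<^sup>+t. ?C * ?g (x - r * s) (x - q * t) \<partial>lborel) =
        (\<lambda>y. ?C * (ennreal (1 / q) * (\<integral>\<^sup>+y'. ?g y y' \<partial>lborel))) (x - r * s)"
      using nn_integral_reflect_scale[of "?g (x - r * s)" q x] \<open>0 < q\<close>
      by (simp add: nn_integral_cmult)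
  qed
  also have "\<dots> = ennreal (1 / r) * (\<integral>\<^sup>+y. ?C * (ennreal (1 / q) * (\<integral>\<^sup>+y'. ?g y y' \<partial>lborel)) \<partial>lborel)"
    by (rule nn_integral_reflect_scale) (use r in measurable)
  also have "\<dots> = ennreal (1 / r) * (?C * (ennreal (1 / q) * gagliardo \<beta> u))"
    by (simp add: gagliardo_def nn_integral_cmult)
  also have "\<dots> = ennreal (M\<^sup>2 * (2 * r) powr (1 + \<beta>) / (r * q)) * gagliardo \<beta> u"
    using r \<open>0 < q\<close>
    by (simp add: mult.assoc[symmetric] ennreal_mult'[symmetric] divide_simps mult_ac)
  finally show ?thesis .
qed

text \<open>Serves to identify the limit of the mollifications with u. One use of Jensen's
  inequality suffices, because the integration over x supplies the second variable of the energy: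
  r^(1 + \<beta>) from the kernel and 1/r from a single substitution.\<close>

lemma nn_integral_mollify_minus_le:
  assumes [measurable]: "u \<in> borel_measurable borel"
    and int: "integrable lborel (\<lambda>x. (u x)\<^sup>2)" and "0 < r" "\<beta> \<ge> 0"
    and M: "\<And>x. mollifier x \<le> M"
  shows "(\<integral>\<^sup>+x. ennreal ((mollify r u x - u x)\<^sup>2) \<partial>lborel) \<le> ennreal (M * r powr \<beta>) * gagliardo \<beta> u"
proof -
  have M0: "M \<ge> 0"
    using M[of 0] mollifier_nonneg[of 0] by linarith
  let ?g = "\<lambda>y y'. ennreal ((u y' - u y)\<^sup>2 * \<bar>y' - y\<bar> powr (- 1 - \<beta>))"
  let ?C = "ennreal (M * r powr (1 + \<beta>))"
  have "(\<integral>\<^sup>+x. ennreal ((mollify r u x - u x)\<^sup>2) \<partial>lborel)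
      \<le> (\<integral>\<^sup>+x. \<integral>\<^sup>+s. ennreal (mollifier s * (u (x - r * s) - u x)\<^sup>2) \<partial>lborel \<partial>lborel)"
    by (intro nn_integral_mono mollify_jensen assms)
  also have "\<dots> \<le> (\<integral>\<^sup>+x. \<integral>\<^sup>+s. ?C * ?g x (x - r * s) \<partial>lborel \<partial>lborel)"
  proof (intro nn_integral_mono)
    fix x s :: real
    have "mollifier s * (u (x - r * s) - u x)\<^sup>2
        \<le> M * r powr (1 + \<beta>) * ((u (x - r * s) - u x)\<^sup>2 * \<bar>(x - r * s) - x\<bar> powr (- 1 - \<beta>))"
    proof (cases "\<bar>s\<bar> \<le> 1")
      case True
      then have "\<bar>(x - r * s) - x\<bar> \<le> r"
        using mult_left_le[of "\<bar>s\<bar>" r] \<open>0 < r\<close> by (simp add: abs_mult)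
      then have "mollifier s * (u (x - r * s) - u x)\<^sup>2
          \<le> M * (r powr (1 + \<beta>) * ((u (x - r * s) - u x)\<^sup>2 * \<bar>(x - r * s) - x\<bar> powr (- 1 - \<beta>)))"
        by (intro mult_mono M M0 square_le_powr_kernel assms) auto
      then show ?thesis
        by (simp add: mult.assoc)
    next
      case False
      then show ?thesis
        using M0 by (simp add: mollifier_eq_0)
    qed
    then show "ennreal (mollifier s * (u (x - r * s) - u x)\<^sup>2) \<le> ?C * ?g x (x - r * s)"
      using M0 by (subst ennreal_mult'[symmetric]) (auto intro!: ennreal_leI)
  qed
  also have "\<dots> = (\<integral>\<^sup>+x. ?C * (ennreal (1 / r) * (\<integral>\<^sup>+y'. ?g x y' \<partial>lborel)) \<partial>lborel)"
  proof (intro nn_integral_cong)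
    fix x
    show "(\<integral>\<^sup>+s. ?C * ?g x (x - r * s) \<partial>lborel) = ?C * (ennreal (1 / r) * (\<integral>\<^sup>+y'. ?g x y' \<partial>lborel))"
      using nn_integral_reflect_scale[of "?g x" r x] \<open>0 < r\<close>
      by (simp add: nn_integral_cmult)
  qed
  also have "\<dots> = ?C * (ennreal (1 / r) * gagliardo \<beta> u)"
    by (simp add: gagliardo_def nn_integral_cmult)
  also have "\<dots> = ennreal (M * r powr \<beta>) * gagliardo \<beta> u"
    using \<open>0 < r\<close> M0
    by (simp add: mult.assoc[symmetric] ennreal_mult'[symmetric] powr_add)
  finally show ?thesis .
qed

subsection \<open>Embedding into continuous functions\<close>

text \<open>Moves the dependence on x from u, which is merely measurable, to the smooth factor.
  Continuity, decay at infinity and differentiation under the integral all start from this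
  form.\<close>

lemma mollify_eq_convolution:
  assumes "\<delta> > 0"
  shows "mollify \<delta> u x = (1 / \<delta>) * (\<integral>t. u t * mollifier ((x - t) / \<delta>) \<partial>lborel)"
proof -
  have "(\<integral>t. u t * mollifier ((x - t) / \<delta>) \<partial>lborel)
      = \<delta> * (\<integral>s. u (x + (- \<delta>) * s) * mollifier ((x - (x + (- \<delta>) * s)) / \<delta>) \<partial>lborel)"
    using lborel_integral_real_affine[of "- \<delta>" "\<lambda>t. u t * mollifier ((x - t) / \<delta>)" x] assms by simp
  then show ?thesis
    using assms by (simp add: mollify_def mult.commute)
qed

lemma continuous_on_mollify:
  assumes [measurable]: "u \<in> borel_measurable borel"
    and int: "integrable lborel (\<lambda>x. (u x)\<^sup>2)" and "\<delta> > 0"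
  shows "continuous_on UNIV (mollify \<delta> u)"
proof -
  obtain M where M: "M > 0" "\<And>x. mollifier x \<le> M"
    using mollifier_bounded by blast
  have "(\<lambda>n. mollify \<delta> u (X n)) \<longlonglongrightarrow> mollify \<delta> u x" if X: "X \<longlonglongrightarrow> x" for X :: "nat \<Rightarrow> real" and x
  proof -
    obtain K where K: "\<And>n. \<bar>X n\<bar> \<le> K"
      using convergent_imp_bounded[OF X] by (auto simp: bounded_iff)
    have "(\<lambda>n. \<integral>t. u t * mollifier ((X n - t) / \<delta>) \<partial>lborel) \<longlonglongrightarrow> (\<integral>t. u t * mollifier ((x - t) / \<delta>) \<partial>lborel)"
    proof (rule integral_dominated_convergence)
      \<comment> \<open>All \<open>X n\<close> lie in [-K, K], so every mollifier occurring here
        vanishes outside [-K - \<delta>, K + \<delta>]. The majorant comes from |u m| <= u^2 +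
        m^2.\<close>
      show "integrable lborel (\<lambda>t. (u t)\<^sup>2 + M\<^sup>2 * indicator {- K - \<delta>..K + \<delta>} t)"
        using int
        by (intro Bochner_Integration.integrable_add integrable_mult_right integrable_real_indicator)
          (auto simp: emeasure_lborel_Icc_eq)
      show "AE t in lborel. (\<lambda>n. u t * mollifier ((X n - t) / \<delta>)) \<longlonglongrightarrow> u t * mollifier ((x - t) / \<delta>)"
        using \<open>\<delta> > 0\<close> X DERIV_isCont[OF smooth_has_derivative[OF smooth_mollifier]]
        by (intro AE_I2 tendsto_mult_left isCont_tendsto_compose[of _ mollifier] tendsto_intros) auto
      show "AE t in lborel. norm (u t * mollifier ((X n - t) / \<delta>)) \<le> (u t)\<^sup>2 + M\<^sup>2 * indicator {- K - \<delta>..K + \<delta>} t" for n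
      proof (intro AE_I2)
        fix t
        let ?m = "mollifier ((X n - t) / \<delta>)"
        have "?m\<^sup>2 \<le> M\<^sup>2 * indicator {- K - \<delta>..K + \<delta>} t"
        proof (cases "\<bar>X n - t\<bar> \<le> \<delta>")
          case True
          then have "t \<in> {- K - \<delta>..K + \<delta>}"
            using K[of n] by auto
          then show ?thesis
            using M mollifier_nonneg by (simp add: power_mono)
        next
          case False
          then have "?m = 0"
            using \<open>\<delta> > 0\<close> by (intro mollifier_eq_0) simp
          then show ?thesis
            by simp
        qed
        moreover have "2 * (\<bar>u t\<bar> * ?m) \<le> (u t)\<^sup>2 + ?m\<^sup>2"
          using zero_le_power2[of "\<bar>u t\<bar> - ?m"] by (simp add: power2_eq_square algebra_simps)
        moreover have "0 \<le> \<bar>u t\<bar> * ?m"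
          by (simp add: mollifier_nonneg)
        ultimately have "\<bar>u t\<bar> * ?m \<le> (u t)\<^sup>2 + M\<^sup>2 * indicator {- K - \<delta>..K + \<delta>} t"
          by linarith
        then show "norm (u t * ?m) \<le> (u t)\<^sup>2 + M\<^sup>2 * indicator {- K - \<delta>..K + \<delta>} t"
          by (simp add: abs_mult mollifier_nonneg)
      qed
    qed measurable
    then show ?thesis
      unfolding mollify_eq_convolution[OF \<open>\<delta> > 0\<close>] by (intro tendsto_mult_left)
  qed
  then show ?thesis
    by (simp add: continuous_on_sequentially comp_def)
qed

lemma norm_square_mult_mollifier_le:
  assumes "\<And>x. mollifier x \<le> M"
  shows "norm (a\<^sup>2 * mollifier z) \<le> M * a\<^sup>2"
  using mult_right_mono[OF assms zero_le_power2[of a]]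
  by (simp add: abs_mult mollifier_nonneg mult.commute)

lemma integrable_square_mult_mollifier:
  assumes [measurable]: "u \<in> borel_measurable borel" "g \<in> borel_measurable borel"
    and int: "integrable lborel (\<lambda>x. (u x)\<^sup>2)"
  shows "integrable lborel (\<lambda>t. (u t)\<^sup>2 * mollifier (g t))"
proof -
  obtain M where "M > 0" and M: "\<And>x. mollifier x \<le> M"
    using mollifier_bounded by blast
  show ?thesis
    by (rule Bochner_Integration.integrable_bound[OF integrable_mult_right[OF int, of M]])
      (use norm_square_mult_mollifier_le[OF M] in \<open>auto intro!: AE_I2 intro: order_trans[OF _ abs_ge_self]\<close>)
qed

text \<open>Replaces u, which need not be integrable, by u^2, which is. When x runs off to infinity,
  u^2 times the moving mollifier has the integrable majorant M u^2.\<close>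

lemma mollify_square_le:
  assumes [measurable]: "u \<in> borel_measurable borel"
    and int: "integrable lborel (\<lambda>x. (u x)\<^sup>2)" and "\<delta> > 0"
  shows "(mollify \<delta> u x)\<^sup>2 \<le> (1 / \<delta>) * (\<integral>t. (u t)\<^sup>2 * mollifier ((x - t) / \<delta>) \<partial>lborel)"
proof -
  have "integrable lborel (\<lambda>t. (u t)\<^sup>2 * mollifier ((x - t) / \<delta>))"
    by (rule integrable_square_mult_mollifier[OF _ _ int]) measurable
  then have int': "integrable lborel (\<lambda>s. mollifier s * (u (x - \<delta> * s))\<^sup>2)"
    using lborel_integrable_real_affine[of "\<lambda>t. (u t)\<^sup>2 * mollifier ((x - t) / \<delta>)" "- \<delta>" x] \<open>\<delta> > 0\<close>
    by (simp add: mult.commute)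
  have "ennreal ((mollify \<delta> u x)\<^sup>2) \<le> (\<integral>\<^sup>+s. ennreal (mollifier s * (u (x - \<delta> * s))\<^sup>2) \<partial>lborel)"
    using mollify_jensen[OF assms, of x 0] by simp
  also have "\<dots> = ennreal (mollify \<delta> (\<lambda>x. (u x)\<^sup>2) x)"
    using nn_integral_eq_integral[OF int'] by (simp add: mollify_def mollifier_nonneg)
  finally have "(mollify \<delta> u x)\<^sup>2 \<le> mollify \<delta> (\<lambda>x. (u x)\<^sup>2) x"
    by (subst (asm) ennreal_le_iff) (auto simp: mollify_def mollifier_nonneg)
  then show ?thesis
    by (simp add: mollify_eq_convolution[OF \<open>\<delta> > 0\<close>])
qed

text \<open>Dominated convergence speaks about sequences, so the limit at infinity is tested along
  them.\<close>

lemma tendsto_at_infinity_if_sequences: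
  fixes f :: "real \<Rightarrow> real"
  assumes "\<And>X :: nat \<Rightarrow> real. filterlim X at_infinity sequentially \<Longrightarrow> (\<lambda>n. f (X n)) \<longlonglongrightarrow> L"
  shows "(f \<longlongrightarrow> L) at_infinity"
proof (rule ccontr)
  assume "\<not> (f \<longlongrightarrow> L) at_infinity"
  then obtain e where e: "e > 0" "\<And>b. \<exists>x. norm x \<ge> b \<and> \<not> dist (f x) L < e"
    unfolding Lim_at_infinity by blast
  from e(2) have "\<forall>n :: nat. \<exists>x. norm x \<ge> real n \<and> \<not> dist (f x) L < e"
    by blast
  then obtain X where X: "\<And>n :: nat. norm (X n) \<ge> real n" "\<And>n. \<not> dist (f (X n)) L < e"
    by metis
  have "filterlim (\<lambda>n. norm (X n)) at_top sequentially"
    by (rule filterlim_at_top_mono[OF filterlim_real_sequentially]) (use X in auto)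
  then have "filterlim X at_infinity sequentially"
    by (simp add: filterlim_at_infinity_conv_norm_at_top)
  from tendstoD[OF assms[OF this] e(1)] X(2) show False
    by simp
qed

lemma mollify_tendsto_0_at_infinity:
  assumes [measurable]: "u \<in> borel_measurable borel"
    and int: "integrable lborel (\<lambda>x. (u x)\<^sup>2)" and "\<delta> > 0"
  shows "(mollify \<delta> u \<longlongrightarrow> 0) at_infinity"
proof (rule tendsto_at_infinity_if_sequences)
  fix X :: "nat \<Rightarrow> real" assume X: "filterlim X at_infinity sequentially"
  obtain M where M: "M > 0" "\<And>x. mollifier x \<le> M"
    using mollifier_bounded by blast
  have "(\<lambda>n. \<integral>t. (u t)\<^sup>2 * mollifier ((X n - t) / \<delta>) \<partial>lborel) \<longlonglongrightarrow> (\<integral>t. 0 \<partial>(lborel :: real measure))"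
  proof (rule integral_dominated_convergence)
    show "integrable lborel (\<lambda>t. M * (u t)\<^sup>2)"
      using int by simp
    show "AE t in lborel. norm ((u t)\<^sup>2 * mollifier ((X n - t) / \<delta>)) \<le> M * (u t)\<^sup>2" for n
      by (intro AE_I2 norm_square_mult_mollifier_le M)
    show "AE t in lborel. (\<lambda>n. (u t)\<^sup>2 * mollifier ((X n - t) / \<delta>)) \<longlonglongrightarrow> 0"
    proof (intro AE_I2 tendsto_eventually)
      fix t :: real
      have "\<forall>\<^sub>F n in sequentially. norm (X n) \<ge> \<bar>t\<bar> + \<delta> + 1"
        using X by (simp add: filterlim_at_infinity_conv_norm_at_top filterlim_at_top)
      then show "\<forall>\<^sub>F n in sequentially. (u t)\<^sup>2 * mollifier ((X n - t) / \<delta>) = 0"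
      proof eventually_elim
        case (elim n)
        then have "mollifier ((X n - t) / \<delta>) = 0"
          using \<open>\<delta> > 0\<close> by (intro mollifier_eq_0) auto
        then show ?case
          by simp
      qed
    qed
  qed measurable
  then have "(\<lambda>n. (1 / \<delta>) * (\<integral>t. (u t)\<^sup>2 * mollifier ((X n - t) / \<delta>) \<partial>lborel)) \<longlonglongrightarrow> (1 / \<delta>) * 0"
    by (intro tendsto_mult_left) simp
  then have lim: "(\<lambda>n. (1 / \<delta>) * (\<integral>t. (u t)\<^sup>2 * mollifier ((X n - t) / \<delta>) \<partial>lborel)) \<longlonglongrightarrow> 0"
    by simp
  have "(\<lambda>n. (mollify \<delta> u (X n))\<^sup>2) \<longlonglongrightarrow> 0"
    by (rule tendsto_sandwich[OF always_eventually always_eventually tendsto_const lim])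
      (use mollify_square_le[OF assms] in auto)
  then show "(\<lambda>n. mollify \<delta> u (X n)) \<longlonglongrightarrow> 0"
    using tendsto_real_sqrt tendsto_rabs_zero_iff by fastforce
qed

text \<open>Scale 1 is where the dyadic telescope starts; this is the share of the L^2 norm in the
  final sup bound.\<close>

lemma mollify_1_bound:
  assumes [measurable]: "u \<in> borel_measurable borel"
    and int: "integrable lborel (\<lambda>x. (u x)\<^sup>2)" and M: "\<And>x. mollifier x \<le> M"
  shows "\<bar>mollify 1 u x\<bar> \<le> sqrt M * sqrt (\<integral>t. (u t)\<^sup>2 \<partial>lborel)"
proof -
  have "(mollify 1 u x)\<^sup>2 \<le> (\<integral>t. (u t)\<^sup>2 * mollifier (x - t) \<partial>lborel)"
    using mollify_square_le[OF assms(1,2), of 1 x] by simp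
  also have "\<dots> \<le> (\<integral>t. M * (u t)\<^sup>2 \<partial>lborel)"
  proof (rule integral_mono)
    show "integrable lborel (\<lambda>t. (u t)\<^sup>2 * mollifier (x - t))"
      by (rule integrable_square_mult_mollifier[OF _ _ int]) measurable
    show "(u t)\<^sup>2 * mollifier (x - t) \<le> M * (u t)\<^sup>2" for t
      using norm_square_mult_mollifier_le[OF M, of "u t" "x - t"] by simp
  qed (use int in simp)
  finally show ?thesis
    using real_sqrt_le_mono by (fastforce simp: real_sqrt_mult[symmetric])
qed

text \<open>The estimate \<open>mollify_diff_le\<close> with r = 2^(-n) and q = r/2: its constant (2
  r)^(1 + \<beta>) / (r r / 2) equals 2^(2 + \<beta>) r^(\<beta> - 1). That bounds the square, so
  the geometric ratio is (1/2)^((\<beta> - 1) / 2).\<close>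

lemma mollify_dyadic_diff_le:
  assumes "u \<in> borel_measurable borel" "integrable lborel (\<lambda>x. (u x)\<^sup>2)" "\<beta> \<ge> 0"
    and fin: "gagliardo \<beta> u < \<infinity>" and M: "\<And>x. mollifier x \<le> M"
  shows "\<bar>mollify ((1/2) ^ n) u x - mollify ((1/2) ^ Suc n) u x\<bar>
    \<le> M * sqrt (2 powr (2 + \<beta>)) * sqrt (enn2real (gagliardo \<beta> u)) * ((1/2) powr ((\<beta> - 1) / 2)) ^ n"
proof -
  have M0: "M \<ge> 0"
    using M[of 0] mollifier_nonneg[of 0] by linarith
  define r :: real where "r = (1/2) ^ n"
  define G where "G = enn2real (gagliardo \<beta> u)"
  have G: "gagliardo \<beta> u = ennreal G" "G \<ge> 0"
    using fin by (auto simp: G_def)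
  have r: "r > 0"
    by (simp add: r_def)
  let ?\<rho> = "((1/2) powr ((\<beta> - 1) / 2)) ^ n :: real"
  have "r powr (\<beta> - 1) = ?\<rho>\<^sup>2"
  proof -
    have "r = (1/2) powr (real n)"
      by (simp add: r_def powr_realpow)
    then have "r powr (\<beta> - 1) = (1/2) powr (real n * (\<beta> - 1))"
      by (simp add: powr_powr)
    also have "real n * (\<beta> - 1) = (\<beta> - 1) / 2 * real (n * 2)"
      by (simp add: field_simps)
    also have "(1/2) powr \<dots> = ((1/2) powr ((\<beta> - 1) / 2)) powr real (n * 2)"
      by (rule powr_powr[symmetric])
    also have "\<dots> = ?\<rho>\<^sup>2"
      by (subst powr_realpow) (simp_all add: power_mult)
    finally show ?thesis .
  qed
  moreover have "M\<^sup>2 * (2 * r) powr (1 + \<beta>) / (r * (r / 2)) = M\<^sup>2 * 2 powr (2 + \<beta>) * r powr (\<beta> - 1)"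
  proof -
    have "2 powr (2 + \<beta>) = 2 * 2 powr (1 + \<beta>)" "r powr (1 + \<beta>) = r powr (\<beta> - 1) * (r * r)"
      using r powr_add[of 2 1 "1 + \<beta>"] powr_add[of r "\<beta> - 1" 2]
      by (simp_all add: powr_numeral power2_eq_square add.commute)
    then show ?thesis
      using r by (simp add: powr_mult field_simps)
  qed
  moreover have "ennreal ((mollify r u x - mollify (r / 2) u x)\<^sup>2)
      \<le> ennreal (M\<^sup>2 * (2 * r) powr (1 + \<beta>) / (r * (r / 2))) * ennreal G"
    using mollify_diff_le[OF assms(1,2), of "r / 2" r \<beta> M x] r assms by (simp add: G)
  ultimately have "ennreal ((mollify r u x - mollify (r / 2) u x)\<^sup>2) \<le> ennreal (M\<^sup>2 * 2 powr (2 + \<beta>) * ?\<rho>\<^sup>2 * G)"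
    using G(2) by (simp add: ennreal_mult'')
  then have "(mollify r u x - mollify (r / 2) u x)\<^sup>2 \<le> M\<^sup>2 * 2 powr (2 + \<beta>) * ?\<rho>\<^sup>2 * G"
    using G(2) by (subst (asm) ennreal_le_iff) auto
  then have "\<bar>mollify r u x - mollify (r / 2) u x\<bar> \<le> sqrt (M\<^sup>2 * 2 powr (2 + \<beta>) * ?\<rho>\<^sup>2 * G)"
    by (rule real_le_rsqrt[of "\<bar>_\<bar>", simplified])
  also have "\<dots> = M * sqrt (2 powr (2 + \<beta>)) * sqrt G * ?\<rho>"
    using M0 by (simp add: real_sqrt_mult mult_ac)
  finally show ?thesis
    by (simp add: r_def G_def)
qed

text \<open>C is obtained before u. Applied to the differences u - \<phi> n, one and the same
  constant then shows that evaluation at 0 is continuous for the norm.\<close>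

theorem sobolev_embedding:
  assumes "1 < \<beta>" "\<beta> < 2"
  obtains C where "C \<ge> 0"
    and "\<And>u. u \<in> sobolev \<beta> \<Longrightarrow> \<exists>v. continuous_on UNIV v \<and> (AE x in lborel. u x = v x) \<and>
      (v \<longlongrightarrow> 0) at_infinity \<and>
      (\<forall>x. \<bar>v x\<bar> \<le> C * (sqrt (\<integral>t. (u t)\<^sup>2 \<partial>lborel) + sqrt (enn2real (gagliardo \<beta> u))))"
proof -
  obtain M where M: "M > 0" "\<And>x. mollifier x \<le> M"
    using mollifier_bounded by blast
  define \<rho> :: real where "\<rho> = (1/2) powr ((\<beta> - 1) / 2)"
  define A where "A = M * sqrt (2 powr (2 + \<beta>))"
  have A: "A \<ge> 0"
    using M by (simp add: A_def)
  \<comment> \<open>The bound \<open>\<rho> < 1\<close> is what the assumption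
    \<open>1 < \<beta>\<close> is for.\<close>
  have \<rho>: "0 < \<rho>" "\<rho> < 1"
    using assms powr_less_mono'[of "1/2" 0 "(\<beta> - 1) / 2"] by (auto simp: \<rho>_def)
  \<comment> \<open>The first entry bounds the average at scale 1, the second sums the geometric
    series of dyadic differences.\<close>
  define C where "C = max (sqrt M) (A / (1 - \<rho>))"
  show thesis
  proof (rule that[of C])
    show "C \<ge> 0"
      using M by (simp add: C_def le_max_iff_disj)
    fix u assume u: "u \<in> sobolev \<beta>"
    then have [measurable]: "u \<in> borel_measurable borel" and int: "integrable lborel (\<lambda>x. (u x)\<^sup>2)"
      and fin: "gagliardo \<beta> u < \<infinity>"
      using sobolev_iff[of \<beta> u] assms by auto
    define G where "G = enn2real (gagliardo \<beta> u)"
    define m where "m n = mollify ((1/2) ^ n) u" for n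
    define D where "D i x = m (Suc i) x - m i x" for i x
    have D: "norm (D i x) \<le> A * sqrt G * \<rho> ^ i" for i x
      using mollify_dyadic_diff_le[OF _ int _ fin M(2), of i x] assms
      by (simp add: D_def m_def A_def \<rho>_def G_def abs_minus_commute)
    have sums: "(\<lambda>i. A * sqrt G * \<rho> ^ i) sums (A * sqrt G * (1 / (1 - \<rho>)))"
      using \<rho> by (intro sums_mult geometric_sums) auto
    \<comment> \<open>The limit of the \<open>m n\<close> as a telescoping series, so that the
      Weierstrass test gives uniform convergence.\<close>
    define v where "v x = m 0 x + (\<Sum>i. D i x)" for x
    have "uniform_limit UNIV (\<lambda>n x. m 0 x + (\<Sum>i<n. D i x)) v sequentially"
      unfolding v_def
      by (intro uniform_limit_intros Weierstrass_m_test[OF D] sums_summable[OF sums])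
    then have ul: "uniform_limit UNIV m v sequentially"
      using sum_lessThan_telescope[of "\<lambda>i. m i _"] by (simp add: D_def)
    have cont: "continuous_on UNIV v"
      by (rule uniform_limit_theorem[OF _ ul])
        (auto simp: m_def intro!: always_eventually continuous_on_mollify int)
    have inf: "(v \<longlongrightarrow> 0) at_infinity"
      by (rule swap_uniform_limit'[where F = sequentially and f = m and g = "\<lambda>_. 0", OF _ tendsto_const ul])
        (auto simp: m_def intro!: always_eventually mollify_tendsto_0_at_infinity int)
    have bound: "\<bar>v x\<bar> \<le> C * (sqrt (\<integral>t. (u t)\<^sup>2 \<partial>lborel) + sqrt G)" for x
    proof -
      have "norm (\<Sum>i. D i x) \<le> A * sqrt G * (1 / (1 - \<rho>))"
        using norm_suminf_le[OF D sums_summable[OF sums]] sums_unique[OF sums] by simp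
      also have "\<dots> = (A / (1 - \<rho>)) * sqrt G"
        by simp
      also have "\<dots> \<le> C * sqrt G"
        by (intro mult_right_mono) (auto simp: C_def G_def)
      finally have "norm (\<Sum>i. D i x) \<le> C * sqrt G" .
      moreover have "\<bar>m 0 x\<bar> \<le> sqrt M * sqrt (\<integral>t. (u t)\<^sup>2 \<partial>lborel)"
        using mollify_1_bound[OF _ int M(2)] by (simp add: m_def)
      moreover have "\<dots> \<le> C * sqrt (\<integral>t. (u t)\<^sup>2 \<partial>lborel)"
        by (intro mult_right_mono) (auto simp: C_def)
      ultimately show ?thesis
        by (simp add: v_def distrib_left)
    qed
    have ae: "AE x in lborel. u x = v x"
    proof -
      have [measurable]: "v \<in> borel_measurable borel"
        by (rule borel_measurable_continuous_onI[OF cont])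
      have [measurable]: "m n \<in> borel_measurable borel" for n
        unfolding m_def by measurable
      \<comment> \<open>Fatou's lemma: the integral of (v - u)^2 is at most the lower limit of the
        integrals of (m n - u)^2, which tend to 0 like a power of the scale.\<close>
      have "(\<integral>\<^sup>+x. ennreal ((v x - u x)\<^sup>2) \<partial>lborel) = (\<integral>\<^sup>+x. liminf (\<lambda>n. ennreal ((m n x - u x)\<^sup>2)) \<partial>lborel)"
      proof (intro nn_integral_cong)
        fix x
        have "(\<lambda>n. ennreal ((m n x - u x)\<^sup>2)) \<longlonglongrightarrow> ennreal ((v x - u x)\<^sup>2)"
          by (intro tendsto_ennrealI tendsto_intros tendsto_uniform_limitI[OF ul]) simp
        then show "ennreal ((v x - u x)\<^sup>2) = liminf (\<lambda>n. ennreal ((m n x - u x)\<^sup>2))"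
          by (rule lim_imp_Liminf[OF sequentially_bot, symmetric])
      qed
      also have "\<dots> \<le> liminf (\<lambda>n. \<integral>\<^sup>+x. ennreal ((m n x - u x)\<^sup>2) \<partial>lborel)"
        by (rule nn_integral_liminf) measurable
      also have "\<dots> \<le> liminf (\<lambda>n. ennreal (M * ((1/2) ^ n) powr \<beta> * G))"
      proof (intro Liminf_mono always_eventually allI)
        fix n
        have "(\<integral>\<^sup>+x. ennreal ((m n x - u x)\<^sup>2) \<partial>lborel) \<le> ennreal (M * ((1/2) ^ n) powr \<beta>) * gagliardo \<beta> u"
          unfolding m_def using assms by (intro nn_integral_mollify_minus_le int M(2)) auto
        also have "gagliardo \<beta> u = ennreal G"
          using fin by (simp add: G_def)
        finally show "(\<integral>\<^sup>+x. ennreal ((m n x - u x)\<^sup>2) \<partial>lborel) \<le> ennreal (M * ((1/2) ^ n) powr \<beta> * G)"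
          by (subst ennreal_mult'') (auto simp: G_def)
      qed
      also have "\<dots> = 0"
      proof (rule lim_imp_Liminf)
        have "(\<lambda>n. ((1/2) ^ n) powr \<beta>) \<longlonglongrightarrow> (0 :: real) powr \<beta>"
          using assms by (intro tendsto_powr2 LIMSEQ_realpow_zero tendsto_const) auto
        then have "(\<lambda>n. M * ((1/2) ^ n) powr \<beta> * G) \<longlonglongrightarrow> M * 0 * G"
          by (intro tendsto_intros) simp
        then show "(\<lambda>n. ennreal (M * ((1/2) ^ n) powr \<beta> * G)) \<longlonglongrightarrow> 0"
          by (simp flip: ennreal_0 add: tendsto_ennrealI)
      qed simp
      finally have "(\<integral>\<^sup>+x. ennreal ((v x - u x)\<^sup>2) \<partial>lborel) = 0"
        by simp
      then have "AE x in lborel. ennreal ((v x - u x)\<^sup>2) = 0"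
        by (subst (asm) nn_integral_0_iff_AE) auto
      then show ?thesis
        by eventually_elim simp
    qed
    show "\<exists>v. continuous_on UNIV v \<and> (AE x in lborel. u x = v x) \<and> (v \<longlongrightarrow> 0) at_infinity \<and>
        (\<forall>x. \<bar>v x\<bar> \<le> C * (sqrt (\<integral>t. (u t)\<^sup>2 \<partial>lborel) + sqrt (enn2real (gagliardo \<beta> u))))"
      using cont ae inf bound unfolding G_def by blast
  qed
qed

subsection \<open>Test functions have finite energy\<close>

lemma continuous_AE_eq_imp_eq:
  fixes v w :: "real \<Rightarrow> real"
  assumes "continuous_on UNIV v" "continuous_on UNIV w" and ae: "AE x in lborel. v x = w x"
  shows "v = w"
proof -
  let ?S = "{x. v x \<noteq> w x}"
  have "open ?S"
    by (rule open_Collect_neq) (use assms in auto)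
  then have "?S \<in> sets lborel"
    by simp
  moreover have "AE x in lborel. x \<notin> ?S"
    using ae by simp
  ultimately have "?S \<in> null_sets lborel"
    by (simp add: AE_iff_null_sets)
  then have "negligible ?S"
    by (simp add: negligible_iff_null_sets null_sets_completionI)
  then have "?S = {}"
    using open_not_negligible \<open>open ?S\<close> by blast
  then show ?thesis
    by auto
qed

lemma continuous_representative_eq:
  assumes "continuous_on UNIV v" "AE x in lborel. u x = v x"
  shows "continuous_representative u = v"
  unfolding continuous_representative_def
proof (rule the_equality)
  fix w assume w: "continuous_on UNIV w \<and> (AE x in lborel. u x = w x)"
  then have "AE x in lborel. w x = v x"
    using assms(2) by (auto elim: AE_mp)
  then show "w = v"
    using continuous_AE_eq_imp_eq w assms(1) by blast
qed (use assms in auto)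

lemma gagliardo_cong_AE:
  assumes "AE x in lborel. u x = v x"
  shows "gagliardo \<beta> u = gagliardo \<beta> v"
  unfolding gagliardo_def
proof (rule nn_integral_cong_AE)
  show "AE y in lborel. (\<integral>\<^sup>+y'. ennreal ((u y' - u y)\<^sup>2 * \<bar>y' - y\<bar> powr (- 1 - \<beta>)) \<partial>lborel) =
      (\<integral>\<^sup>+y'. ennreal ((v y' - v y)\<^sup>2 * \<bar>y' - y\<bar> powr (- 1 - \<beta>)) \<partial>lborel)"
    using assms
  proof eventually_elim
    case (elim y)
    show ?case
      by (rule nn_integral_cong_AE) (use assms in eventually_elim, simp add: elim)
  qed
qed

lemma gagliardo_mono:
  assumes "\<And>x y. \<bar>w x - w y\<bar> \<le> \<bar>v x - v y\<bar>"
  shows "gagliardo \<beta> w \<le> gagliardo \<beta> v"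
  unfolding gagliardo_def
  using assms by (intro nn_integral_mono ennreal_leI mult_right_mono) (auto simp: abs_le_square_iff)

text \<open>The kernel becomes a function of the increment length z alone, so short and long
  increments can be treated separately.\<close>

lemma gagliardo_shift:
  assumes [measurable]: "u \<in> borel_measurable borel"
  shows "gagliardo \<beta> u = (\<integral>\<^sup>+y. \<integral>\<^sup>+z. ennreal ((u (y + z) - u y)\<^sup>2 * \<bar>z\<bar> powr (- 1 - \<beta>)) \<partial>lborel \<partial>lborel)"
  unfolding gagliardo_def
proof (rule nn_integral_cong)
  fix y
  show "(\<integral>\<^sup>+y'. ennreal ((u y' - u y)\<^sup>2 * \<bar>y' - y\<bar> powr (- 1 - \<beta>)) \<partial>lborel) =
      (\<integral>\<^sup>+z. ennreal ((u (y + z) - u y)\<^sup>2 * \<bar>z\<bar> powr (- 1 - \<beta>)) \<partial>lborel)"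
    using nn_integral_real_affine[of "\<lambda>y'. ennreal ((u y' - u y)\<^sup>2 * \<bar>y' - y\<bar> powr (- 1 - \<beta>))" 1 y]
    by simp
qed

lemma square_diff_le: "(a - b)\<^sup>2 \<le> 2 * a\<^sup>2 + 2 * b\<^sup>2" for a b :: real
  using zero_le_power2[of "a + b"] by (simp add: power2_eq_square algebra_simps)

lemma integrable_square_diff:
  fixes u v :: "real \<Rightarrow> real"
  assumes [measurable]: "u \<in> borel_measurable borel" "v \<in> borel_measurable borel"
    and "integrable lborel (\<lambda>x. (u x)\<^sup>2)" "integrable lborel (\<lambda>x. (v x)\<^sup>2)"
  shows "integrable lborel (\<lambda>x. (u x - v x)\<^sup>2)"
  by (rule Bochner_Integration.integrable_bound[of _ "\<lambda>x. 2 * (u x)\<^sup>2 + 2 * (v x)\<^sup>2"])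
    (use assms in \<open>auto intro!: AE_I2 square_diff_le\<close>)

lemma gagliardo_diff_le:
  assumes [measurable]: "u \<in> borel_measurable borel" "v \<in> borel_measurable borel"
  shows "gagliardo \<beta> (\<lambda>x. u x - v x) \<le> 2 * gagliardo \<beta> u + 2 * gagliardo \<beta> v"
proof -
  let ?g = "\<lambda>u y y'. ennreal ((u y' - u y)\<^sup>2 * \<bar>y' - y\<bar> powr (- 1 - \<beta>))"
  have "gagliardo \<beta> (\<lambda>x. u x - v x) \<le>
      (\<integral>\<^sup>+y. \<integral>\<^sup>+y'. 2 * ?g u y y' + 2 * ?g v y y' \<partial>lborel \<partial>lborel)"
    unfolding gagliardo_def
  proof (intro nn_integral_mono)
    fix y y'
    have "((u y' - v y') - (u y - v y))\<^sup>2 \<le> 2 * (u y' - u y)\<^sup>2 + 2 * (v y' - v y)\<^sup>2"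
      using square_diff_le[of "u y' - u y" "v y' - v y"] by (simp add: algebra_simps)
    from mult_right_mono[OF this, of "\<bar>y' - y\<bar> powr (- 1 - \<beta>)"]
    have "?g (\<lambda>x. u x - v x) y y' \<le> ennreal (2 * ((u y' - u y)\<^sup>2 * \<bar>y' - y\<bar> powr (- 1 - \<beta>))
        + 2 * ((v y' - v y)\<^sup>2 * \<bar>y' - y\<bar> powr (- 1 - \<beta>)))"
      by (intro ennreal_leI) (simp add: algebra_simps)
    then show "?g (\<lambda>x. u x - v x) y y' \<le> 2 * ?g u y y' + 2 * ?g v y y'"
      by (simp add: ennreal_plus ennreal_mult')
  qed
  also have "\<dots> = 2 * gagliardo \<beta> u + 2 * gagliardo \<beta> v"
    unfolding gagliardo_def by (simp add: nn_integral_add nn_integral_cmult)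
  finally show ?thesis .
qed

lemma sobolev_diff:
  assumes "0 < \<beta>" "\<beta> < 2" "u \<in> sobolev \<beta>" "v \<in> sobolev \<beta>"
  shows "(\<lambda>x. u x - v x) \<in> sobolev \<beta>"
proof -
  have "2 * gagliardo \<beta> u + 2 * gagliardo \<beta> v < \<infinity>"
    using assms by (auto simp: sobolev_iff ennreal_mult_less_top)
  then show ?thesis
    using assms integrable_square_diff[of u v] gagliardo_diff_le[of u v \<beta>]
    by (auto simp: sobolev_iff intro: le_less_trans)
qed

section \<open>Finiteness of the energy: short and long increments\<close>

lemma nn_integral_abs_le:
  fixes f :: "real \<Rightarrow> ennreal"
  assumes [measurable]: "f \<in> borel_measurable borel"
  shows "(\<integral>\<^sup>+z. f \<bar>z\<bar> \<partial>lborel) \<le> 2 * (\<integral>\<^sup>+z. indicator {0..} z * f z \<partial>lborel)"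
proof -
  \<comment> \<open>The point 0 is counted in both halves, hence an inequality; it is enough for
    finiteness.\<close>
  have "(\<integral>\<^sup>+z. f \<bar>z\<bar> \<partial>lborel) \<le> (\<integral>\<^sup>+z. indicator {0..} z * f z + indicator {0..} (- z) * f (- z) \<partial>lborel)"
    by (intro nn_integral_mono) (auto simp: indicator_def abs_if)
  also have "\<dots> = (\<integral>\<^sup>+z. indicator {0..} z * f z \<partial>lborel) + (\<integral>\<^sup>+z. indicator {0..} (- z) * f (- z) \<partial>lborel)"
    by (rule nn_integral_add) measurable
  also have "(\<integral>\<^sup>+z. indicator {0..} (- z) * f (- z) \<partial>lborel) = (\<integral>\<^sup>+z. indicator {0..} z * f z \<partial>lborel)"
    using nn_integral_real_affine[of "\<lambda>z. indicator {0..} z * f z" "- 1" 0] by simp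
  finally show ?thesis
    by (simp add: mult_2)
qed

text \<open>The weight |z|^(1 - \<beta>) is what a Lipschitz bound leaves of the kernel, |z|^2
  |z|^(-1 - \<beta>). It is integrable at 0 because 1 - \<beta> > -1.\<close>

lemma nn_integral_powr_near_finite:
  assumes "\<beta> < (2 :: real)"
  shows "(\<integral>\<^sup>+z. ennreal (indicator {..1} \<bar>z\<bar> * \<bar>z\<bar> powr (1 - \<beta>)) \<partial>lborel) < \<infinity>"
proof -
  have "(\<integral>\<^sup>+z. ennreal (indicator {..1} \<bar>z\<bar> * \<bar>z\<bar> powr (1 - \<beta>)) \<partial>lborel)
      \<le> 2 * (\<integral>\<^sup>+z. indicator {0..} z * ennreal (indicator {..1} z * z powr (1 - \<beta>)) \<partial>lborel)"
    using nn_integral_abs_le[of "\<lambda>z. ennreal (indicator {..1} z * z powr (1 - \<beta>))"] by simp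
  also have "(\<integral>\<^sup>+z. indicator {0..} z * ennreal (indicator {..1} z * z powr (1 - \<beta>)) \<partial>lborel)
      = (\<integral>\<^sup>+z. ennreal (z powr (1 - \<beta>)) * indicator {0..1} z \<partial>lborel)"
    by (intro nn_integral_cong) (auto simp: indicator_def)
  also have "\<dots> = ennreal (1 powr ((1 - \<beta>) + 1) / ((1 - \<beta>) + 1))"
    using has_integral_powr_from_0[of "1 - \<beta>" 1] assms
    by (intro nn_integral_has_integral_lebesgue') auto
  finally show ?thesis
    by (rule le_less_trans) (simp add: ennreal_mult_less_top)
qed

lemma nn_integral_powr_far_finite:
  assumes "(0 :: real) < \<beta>"
  shows "(\<integral>\<^sup>+z. ennreal (indicator {1..} \<bar>z\<bar> * \<bar>z\<bar> powr (- 1 - \<beta>)) \<partial>lborel) < \<infinity>"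
proof -
  have "(\<integral>\<^sup>+z. ennreal (indicator {1..} \<bar>z\<bar> * \<bar>z\<bar> powr (- 1 - \<beta>)) \<partial>lborel)
      \<le> 2 * (\<integral>\<^sup>+z. indicator {0..} z * ennreal (indicator {1..} z * z powr (- 1 - \<beta>)) \<partial>lborel)"
    using nn_integral_abs_le[of "\<lambda>z. ennreal (indicator {1..} z * z powr (- 1 - \<beta>))"] by simp
  also have "(\<integral>\<^sup>+z. indicator {0..} z * ennreal (indicator {1..} z * z powr (- 1 - \<beta>)) \<partial>lborel)
      = (\<integral>\<^sup>+z. ennreal (z powr (- 1 - \<beta>)) * indicator {1..} z \<partial>lborel)"
    by (intro nn_integral_cong) (auto simp: indicator_def)
  also have "\<dots> = ennreal (- (1 powr ((- 1 - \<beta>) + 1)) / ((- 1 - \<beta>) + 1))"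
    using has_integral_powr_to_inf[of "- 1 - \<beta>" 1] assms
    by (intro nn_integral_has_integral_lebesgue') auto
  finally show ?thesis
    by (rule le_less_trans) (simp add: ennreal_mult_less_top)
qed

lemma nn_integral_increments_finite:
  fixes \<kappa> :: "real \<Rightarrow> real"
  assumes [measurable]: "u \<in> borel_measurable borel" "\<kappa> \<in> borel_measurable borel"
    and int: "integrable lborel (\<lambda>x. (u x)\<^sup>2)"
    and nonneg: "\<And>z. \<kappa> z \<ge> 0" and fin: "(\<integral>\<^sup>+z. ennreal (\<kappa> z) \<partial>lborel) < \<infinity>"
  shows "(\<integral>\<^sup>+y. \<integral>\<^sup>+z. ennreal ((u (y + z) - u y)\<^sup>2 * \<kappa> z) \<partial>lborel \<partial>lborel) < \<infinity>"
proof -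
  let ?N = "\<integral>\<^sup>+x. ennreal ((u x)\<^sup>2) \<partial>lborel"
  have "(\<integral>\<^sup>+y. \<integral>\<^sup>+z. ennreal ((u (y + z) - u y)\<^sup>2 * \<kappa> z) \<partial>lborel \<partial>lborel) \<le>
      (\<integral>\<^sup>+y. \<integral>\<^sup>+z. ennreal (\<kappa> z) * (2 * ennreal ((u (y + z))\<^sup>2) + 2 * ennreal ((u y)\<^sup>2)) \<partial>lborel \<partial>lborel)"
  proof (intro nn_integral_mono)
    fix y z
    have "ennreal ((u (y + z) - u y)\<^sup>2 * \<kappa> z) \<le> ennreal (\<kappa> z * (2 * (u (y + z))\<^sup>2 + 2 * (u y)\<^sup>2))"
      using mult_right_mono[OF square_diff_le nonneg] by (intro ennreal_leI) (simp add: mult.commute)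
    then show "ennreal ((u (y + z) - u y)\<^sup>2 * \<kappa> z) \<le> ennreal (\<kappa> z) * (2 * ennreal ((u (y + z))\<^sup>2) + 2 * ennreal ((u y)\<^sup>2))"
      by (simp add: ennreal_mult' nonneg)
  qed
  also have "\<dots> = (\<integral>\<^sup>+z. \<integral>\<^sup>+y. ennreal (\<kappa> z) * (2 * ennreal ((u (y + z))\<^sup>2) + 2 * ennreal ((u y)\<^sup>2)) \<partial>lborel \<partial>lborel)"
    by (rule lborel_pair.Fubini') measurable
  also have "\<dots> = (\<integral>\<^sup>+z. ennreal (\<kappa> z) * (2 * ?N + 2 * ?N) \<partial>lborel)"
  proof (intro nn_integral_cong)
    fix z
    have "(\<integral>\<^sup>+y. ennreal ((u (y + z))\<^sup>2) \<partial>lborel) = ?N"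
      using nn_integral_translate[of "\<lambda>y. ennreal ((u y)\<^sup>2)" "- z"] by simp
    then show "(\<integral>\<^sup>+y. ennreal (\<kappa> z) * (2 * ennreal ((u (y + z))\<^sup>2) + 2 * ennreal ((u y)\<^sup>2)) \<partial>lborel)
        = ennreal (\<kappa> z) * (2 * ?N + 2 * ?N)"
      by (simp add: nn_integral_cmult nn_integral_add)
  qed
  also have "\<dots> = (\<integral>\<^sup>+z. ennreal (\<kappa> z) \<partial>lborel) * (2 * ?N + 2 * ?N)"
    by (rule nn_integral_multc) measurable
  also have "\<dots> < \<infinity>"
    using fin nn_integral_square_finite[OF int] by (simp add: ennreal_mult_less_top)
  finally show ?thesis .
qed

text \<open>Away from 0 the kernel is integrable, so increments with |z| >= 1 are controlled by the
  L^2 norm, and only short increments need the majorant f. For the inclusion between Sobolev spaces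
  f is the integrand of the larger exponent; for test functions it is a Lipschitz bound.\<close>

lemma gagliardo_finite_if_near:
  fixes f :: "real \<Rightarrow> real \<Rightarrow> ennreal"
  assumes [measurable]: "u \<in> borel_measurable borel" and f [measurable]: "case_prod f \<in> borel_measurable (lborel \<Otimes>\<^sub>M lborel)"
    and int: "integrable lborel (\<lambda>x. (u x)\<^sup>2)" and "\<beta> > 0"
    and near: "\<And>y z. \<bar>z\<bar> < 1 \<Longrightarrow> ennreal ((u (y + z) - u y)\<^sup>2 * \<bar>z\<bar> powr (- 1 - \<beta>)) \<le> f y z"
    and fin: "(\<integral>\<^sup>+y. \<integral>\<^sup>+z. f y z \<partial>lborel \<partial>lborel) < \<infinity>"
  shows "gagliardo \<beta> u < \<infinity>"
proof -
  let ?\<kappa> = "\<lambda>z. indicator {1..} \<bar>z\<bar> * \<bar>z\<bar> powr (- 1 - \<beta>) :: real"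
  have "gagliardo \<beta> u \<le> (\<integral>\<^sup>+y. \<integral>\<^sup>+z. f y z + ennreal ((u (y + z) - u y)\<^sup>2 * ?\<kappa> z) \<partial>lborel \<partial>lborel)"
    unfolding gagliardo_shift[OF assms(1)]
  proof (intro nn_integral_mono)
    fix y z :: real
    show "ennreal ((u (y + z) - u y)\<^sup>2 * \<bar>z\<bar> powr (- 1 - \<beta>)) \<le> f y z + ennreal ((u (y + z) - u y)\<^sup>2 * ?\<kappa> z)"
      using near[of z y] by (cases "\<bar>z\<bar> < 1") auto
  qed
  also have "\<dots> = (\<integral>\<^sup>+y. \<integral>\<^sup>+z. f y z \<partial>lborel \<partial>lborel) +
      (\<integral>\<^sup>+y. \<integral>\<^sup>+z. ennreal ((u (y + z) - u y)\<^sup>2 * ?\<kappa> z) \<partial>lborel \<partial>lborel)"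
    by (simp add: nn_integral_add)
  also have "\<dots> < \<infinity>"
    using fin nn_integral_increments_finite[OF assms(1) _ int _ nn_integral_powr_far_finite[OF \<open>\<beta> > 0\<close>]]
    by simp
  finally show ?thesis .
qed

lemma sobolev_antimono:
  assumes "0 < \<beta>" "\<beta> \<le> \<alpha>" "\<alpha> < 2"
  shows "sobolev \<alpha> \<subseteq> sobolev \<beta>"
proof
  fix u assume "u \<in> sobolev \<alpha>"
  then have [measurable]: "u \<in> borel_measurable borel" and int: "integrable lborel (\<lambda>x. (u x)\<^sup>2)"
    and fin: "gagliardo \<alpha> u < \<infinity>"
    using sobolev_iff[of \<alpha> u] assms by auto
  have "gagliardo \<beta> u < \<infinity>"
  proof (rule gagliardo_finite_if_near[OF _ _ int \<open>0 < \<beta>\<close>])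
    show "(\<integral>\<^sup>+y. \<integral>\<^sup>+z. ennreal ((u (y + z) - u y)\<^sup>2 * \<bar>z\<bar> powr (- 1 - \<alpha>)) \<partial>lborel \<partial>lborel) < \<infinity>"
      using fin by (simp add: gagliardo_shift)
    fix y z :: real
    assume "\<bar>z\<bar> < 1"
    then show "ennreal ((u (y + z) - u y)\<^sup>2 * \<bar>z\<bar> powr (- 1 - \<beta>)) \<le> ennreal ((u (y + z) - u y)\<^sup>2 * \<bar>z\<bar> powr (- 1 - \<alpha>))"
      using assms by (intro ennreal_leI mult_left_mono powr_mono') auto
  qed measurable
  then show "u \<in> sobolev \<beta>"
    using int assms by (simp add: sobolev_iff)
qed

section \<open>Test functions and smoothness of mollifications\<close>

lemma test_function_smooth: "\<phi> \<in> test_functions \<Longrightarrow> smooth \<phi>"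
  by (simp add: test_functions_def smooth_def)

lemma test_function_0: "\<phi> \<in> test_functions \<Longrightarrow> \<phi> 0 = 0"
  using closure_subset[of "{x. \<phi> x \<noteq> 0}"] by (auto simp: test_functions_def)

lemma test_function_support:
  assumes "\<phi> \<in> test_functions"
  obtains R where "R > 0" "\<And>x. \<bar>x\<bar> > R \<Longrightarrow> \<phi> x = 0"
proof -
  have "bounded {x. \<phi> x \<noteq> 0}"
    using assms bounded_subset[OF compact_imp_bounded closure_subset] by (auto simp: test_functions_def)
  then obtain R where "R > 0" "\<forall>x\<in>{x. \<phi> x \<noteq> 0}. norm x \<le> R"
    by (auto simp: bounded_pos)
  then show thesis
    by (intro that[of R]) (auto simp: not_le[symmetric])
qed

text \<open>Makes \<open>sobolev_norm\<close> meaningful on the differences u - \<phi> n: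
  \<open>enn2real\<close> sends infinity to 0, so for a function of infinite energy a small norm
  would carry no information.\<close>

lemma test_function_in_sobolev:
  assumes \<phi>: "\<phi> \<in> test_functions" and "0 < \<beta>" "\<beta> < 2"
  shows "\<phi> \<in> sobolev \<beta>"
proof -
  obtain R where R: "R > 0" "\<And>x. \<bar>x\<bar> > R \<Longrightarrow> \<phi> x = 0"
    using test_function_support[OF \<phi>] by blast
  note smooth = test_function_smooth[OF \<phi>]
  have [measurable]: "\<phi> \<in> borel_measurable borel"
    by (rule borel_measurable_continuous_onI[OF smooth_continuous_on[OF smooth]])
  have int: "integrable lborel (\<lambda>x. (\<phi> x)\<^sup>2)"
    by (rule integrable_lborel_compact_support[of _ "- R" R])
      (use R in \<open>auto intro!: continuous_on_power smooth_continuous_on[OF smooth]\<close>)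
  \<comment> \<open>For |y| <= R + 1 and |z| < 1 the segment from y to y + z stays in
    [-R - 2, R + 2], where the mean value bound applies. For |y| > R + 1 both values of \<phi>
    vanish.\<close>
  have "bounded (deriv \<phi> ` {- R - 2..R + 2})"
    by (intro compact_imp_bounded compact_continuous_image smooth_continuous_on smooth_deriv smooth) auto
  then obtain L where L: "L > 0" "\<And>x. x \<in> {- R - 2..R + 2} \<Longrightarrow> norm (deriv \<phi> x) \<le> L"
    by (auto simp: bounded_pos)
  let ?f = "\<lambda>y z. ennreal (indicator {- R - 1..R + 1} y * L\<^sup>2) * ennreal (indicator {..1} \<bar>z\<bar> * \<bar>z\<bar> powr (1 - \<beta>))"
  have "gagliardo \<beta> \<phi> < \<infinity>"
  proof (rule gagliardo_finite_if_near[OF _ _ int \<open>0 < \<beta>\<close>])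
    have "(\<integral>\<^sup>+y. \<integral>\<^sup>+z. ?f y z \<partial>lborel \<partial>lborel) =
        (\<integral>\<^sup>+y. ennreal (indicator {- R - 1..R + 1} y * L\<^sup>2) \<partial>lborel) *
        (\<integral>\<^sup>+z. ennreal (indicator {..1} \<bar>z\<bar> * \<bar>z\<bar> powr (1 - \<beta>)) \<partial>lborel)"
      by (simp add: nn_integral_cmult nn_integral_multc)
    moreover have "(\<integral>\<^sup>+y. ennreal (indicator {- R - 1..R + 1} y * L\<^sup>2) \<partial>lborel)
        = (\<integral>\<^sup>+y. ennreal (L\<^sup>2) * indicator {- R - 1..R + 1} y \<partial>lborel)"
      by (intro nn_integral_cong) (auto simp: indicator_def)
    moreover have "\<dots> < \<infinity>"
      by (subst nn_integral_cmult_indicator) (auto simp: emeasure_lborel_Icc_eq ennreal_mult_less_top)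
    ultimately show "(\<integral>\<^sup>+y. \<integral>\<^sup>+z. ?f y z \<partial>lborel \<partial>lborel) < \<infinity>"
      using nn_integral_powr_near_finite[OF \<open>\<beta> < 2\<close>] by (simp add: ennreal_mult_less_top)
    fix y z :: real
    assume z: "\<bar>z\<bar> < 1"
    have "(\<phi> (y + z) - \<phi> y)\<^sup>2 * \<bar>z\<bar> powr (- 1 - \<beta>) \<le> (indicator {- R - 1..R + 1} y * L\<^sup>2) * (indicator {..1} \<bar>z\<bar> * \<bar>z\<bar> powr (1 - \<beta>))"
    proof (cases "\<bar>y\<bar> \<le> R + 1")
      case True
      have "norm (\<phi> (y + z) - \<phi> y) \<le> L * norm ((y + z) - y)"
        by (rule field_differentiable_bound[of "{- R - 2..R + 2}" \<phi> "deriv \<phi>"])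
          (use True z L in \<open>auto intro: has_field_derivative_at_within smooth_has_derivative smooth\<close>)
      then have "(\<phi> (y + z) - \<phi> y)\<^sup>2 \<le> (L * \<bar>z\<bar>)\<^sup>2"
        using L(1) by (simp add: abs_le_square_iff[symmetric] abs_mult)
      then have "(\<phi> (y + z) - \<phi> y)\<^sup>2 * \<bar>z\<bar> powr (- 1 - \<beta>) \<le> (L * \<bar>z\<bar>)\<^sup>2 * \<bar>z\<bar> powr (- 1 - \<beta>)"
        by (rule mult_right_mono) simp
      also have "\<dots> = L\<^sup>2 * \<bar>z\<bar> powr (1 - \<beta>)"
        using powr_add[of "\<bar>z\<bar>" 2 "- 1 - \<beta>"] by (cases "z = 0") (auto simp: power_mult_distrib powr_numeral)
      also have "\<dots> = (indicator {- R - 1..R + 1} y * L\<^sup>2) * (indicator {..1} \<bar>z\<bar> * \<bar>z\<bar> powr (1 - \<beta>))"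
        using True z by (auto simp: indicator_def abs_le_iff)
      finally show ?thesis .
    next
      case False
      then have "\<phi> (y + z) = 0" "\<phi> y = 0"
        using z by (auto intro!: R)
      then show ?thesis
        using False by simp
    qed
    then show "ennreal ((\<phi> (y + z) - \<phi> y)\<^sup>2 * \<bar>z\<bar> powr (- 1 - \<beta>)) \<le> ?f y z"
      by (subst ennreal_mult[symmetric]) (auto intro: ennreal_leI)
  qed measurable
  then show ?thesis
    using int assms by (simp add: sobolev_iff)
qed

text \<open>Convolutions of w with smooth functions form a class closed under differentiation,
  because the derivative falls on the smooth factor. Compact support of w turns them into integrals
  over a fixed interval, where the Leibniz rule applies.\<close>

lemma smooth_mollify:
  assumes w: "continuous_on UNIV w" "\<And>x. x \<notin> {a..b} \<Longrightarrow> w x = 0" and "\<delta> > 0"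
  shows "smooth (mollify \<delta> w)"
proof (rule smooth_coinduct)
  let ?S = "{\<lambda>x. integral (cbox a b) (\<lambda>t. w t * g (x - t)) |g. smooth g}"
  \<comment> \<open>The rescaled mollifier, with \<open>+ 0\<close> to match the shape of
    \<open>smooth_affine\<close>.\<close>
  let ?g = "\<lambda>z. (1 / \<delta>) * mollifier ((1 / \<delta>) * z + 0)"
  have g: "smooth ?g"
    by (intro smooth_cmult smooth_affine smooth_mollifier)
  have cont: "continuous_on A (\<lambda>t. h (x - t))" if "smooth h" for h A and x :: real
    by (rule continuous_on_compose2[OF smooth_continuous_on[OF that, of UNIV]])
      (auto intro!: continuous_intros)
  have "mollify \<delta> w x = integral (cbox a b) (\<lambda>t. w t * ?g (x - t))" for x
  proof -
    have "set_integrable lborel {a..b} (\<lambda>t. w t * ?g (x - t))"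
      by (intro borel_integrable_atLeastAtMost' continuous_on_mult cont[OF g] continuous_on_subset[OF w(1)]) auto
    then have "integral (cbox a b) (\<lambda>t. w t * ?g (x - t)) = (\<integral>t. indicator {a..b} t *\<^sub>R (w t * ?g (x - t)) \<partial>lborel)"
      using set_borel_integral_eq_integral(2) by (fastforce simp: set_lebesgue_integral_def)
    also have "\<dots> = (\<integral>t. (1 / \<delta>) * (w t * mollifier ((x - t) / \<delta>)) \<partial>lborel)"
      using w(2) by (intro Bochner_Integration.integral_cong) (auto simp: indicator_def)
    also have "\<dots> = mollify \<delta> w x"
      unfolding mollify_eq_convolution[OF \<open>\<delta> > 0\<close>] by simp
    finally show ?thesis
      by (rule sym)
  qed
  then show "mollify \<delta> w \<in> ?S"
    using g by (auto intro!: exI[of _ ?g])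
  fix h assume "h \<in> ?S"
  then obtain g where h: "h = (\<lambda>x. integral (cbox a b) (\<lambda>t. w t * g (x - t)))" and g: "smooth g"
    by blast
  have "(h has_real_derivative integral (cbox a b) (\<lambda>t. w t * deriv g (x - t))) (at x)" for x
    unfolding h
  proof (rule leibniz_rule_field_derivative[where U = UNIV])
    show "((\<lambda>x. w t * g (x - t)) has_real_derivative w t * deriv g (x - t)) (at x within UNIV)" for x t
      using smooth_has_derivative[OF g, of "x - t"] DERIV_shift[of g _ x "- t"] by (simp add: DERIV_cmult)
    show "(\<lambda>t. w t * g (x - t)) integrable_on cbox a b" for x
      by (intro integrable_continuous continuous_on_mult cont[OF g] continuous_on_subset[OF w(1)]) auto
    have "continuous_on UNIV (\<lambda>(x, t). w t * deriv g (x - t))"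
      unfolding split_beta
      by (intro continuous_on_mult continuous_on_compose2[OF w(1)]
          continuous_on_compose2[OF smooth_continuous_on[OF smooth_deriv[OF g], of UNIV]] continuous_intros) auto
    then show "continuous_on (UNIV \<times> cbox a b) (\<lambda>(x, t). w t * deriv g (x - t))"
      by (rule continuous_on_subset) simp
  qed auto
  then show "\<exists>g'\<in>?S. \<forall>x. (h has_real_derivative g' x) (at x)"
    using smooth_deriv[OF g] by (intro bexI[of _ "\<lambda>x. integral (cbox a b) (\<lambda>t. w t * deriv g (x - t))"]) auto
qed

subsection \<open>Approximation by test functions\<close>

text \<open>For \<epsilon> > 0 this moves a towards 0 by \<epsilon> and stops at 0. As a minus its
  projection onto [-\<epsilon>, \<epsilon>], it inherits continuity from \<open>min\<close> and
  \<open>max\<close>.\<close>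

definition soft_threshold :: "real \<Rightarrow> real \<Rightarrow> real" where
  "soft_threshold \<epsilon> a = a - max (- \<epsilon>) (min \<epsilon> a)"

lemma soft_threshold_contraction:
  "\<epsilon> > 0 \<Longrightarrow> \<bar>soft_threshold \<epsilon> a - soft_threshold \<epsilon> b\<bar> \<le> \<bar>a - b\<bar>"
  unfolding soft_threshold_def by (auto simp: max_def min_def abs_if)

lemma abs_soft_threshold_le: "\<epsilon> > 0 \<Longrightarrow> \<bar>soft_threshold \<epsilon> a\<bar> \<le> \<bar>a\<bar>"
  unfolding soft_threshold_def by (auto simp: max_def min_def abs_if)

lemma soft_threshold_dist: "\<epsilon> > 0 \<Longrightarrow> \<bar>soft_threshold \<epsilon> a - a\<bar> \<le> \<epsilon>"
  unfolding soft_threshold_def by (auto simp: max_def min_def abs_if)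

lemma soft_threshold_eq_0: "\<bar>a\<bar> \<le> \<epsilon> \<Longrightarrow> soft_threshold \<epsilon> a = 0"
  unfolding soft_threshold_def by (auto simp: max_def min_def abs_le_iff)

lemma continuous_on_soft_threshold [continuous_intros]:
  "continuous_on A f \<Longrightarrow> continuous_on A (\<lambda>x. soft_threshold \<epsilon> (f x))"
  unfolding soft_threshold_def by (intro continuous_intros)

lemma mollify_in_test_functions:
  assumes w: "continuous_on UNIV w" and supp: "\<And>x. w x \<noteq> 0 \<Longrightarrow> r \<le> \<bar>x\<bar> \<and> \<bar>x\<bar> \<le> R"
    and "0 < \<delta>" "\<delta> < r"
  shows "mollify \<delta> w \<in> test_functions"
proof -
  \<comment> \<open>Mollification widens the support by at most \<delta>; since \<delta> < r, the
    widened set still excludes 0.\<close>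
  let ?K = "{x. r - \<delta> \<le> \<bar>x\<bar> \<and> \<bar>x\<bar> \<le> R + \<delta>}"
  have "{x. mollify \<delta> w x \<noteq> 0} \<subseteq> ?K"
  proof (intro subsetI CollectI, rule ccontr)
    fix x assume x: "x \<in> {x. mollify \<delta> w x \<noteq> 0}" and "\<not> (r - \<delta> \<le> \<bar>x\<bar> \<and> \<bar>x\<bar> \<le> R + \<delta>)"
    have "mollifier s * w (x - \<delta> * s) = 0" for s
    proof (cases "\<bar>s\<bar> \<le> 1")
      case True
      then have "\<bar>\<delta> * s\<bar> \<le> \<delta>"
        using \<open>0 < \<delta>\<close> mult_left_le[of "\<bar>s\<bar>" \<delta>] by (simp add: abs_mult)
      then have "\<not> (r \<le> \<bar>x - \<delta> * s\<bar> \<and> \<bar>x - \<delta> * s\<bar> \<le> R)"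
        using \<open>\<not> (r - \<delta> \<le> \<bar>x\<bar> \<and> \<bar>x\<bar> \<le> R + \<delta>)\<close> by linarith
      then have "w (x - \<delta> * s) = 0"
        using supp by blast
      then show ?thesis
        by simp
    qed (simp add: mollifier_eq_0)
    then have "mollify \<delta> w x = 0"
      unfolding mollify_def by (subst Bochner_Integration.integral_cong[OF refl, of _ _ "\<lambda>_. 0"]) auto
    then show False
      using x by simp
  qed
  moreover have "closed ?K"
    by (intro closed_Collect_conj closed_Collect_le continuous_intros)
  ultimately have cl: "closure {x. mollify \<delta> w x \<noteq> 0} \<subseteq> ?K"
    by (rule closure_minimal)
  have "bounded ?K"
    unfolding bounded_iff by (intro exI[of _ "R + \<delta>"]) auto
  then have "compact (closure {x. mollify \<delta> w x \<noteq> 0})"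
    using bounded_subset[OF _ cl] by (simp add: compact_eq_bounded_closed)
  moreover have "smooth (mollify \<delta> w)"
  proof (rule smooth_mollify[OF w _ \<open>0 < \<delta>\<close>])
    show "w x = 0" if "x \<notin> {- R..R}" for x
      using supp[of x] that by (cases "w x = 0") (auto simp: abs_le_iff)
  qed
  ultimately show ?thesis
    using cl \<open>\<delta> < r\<close> by (auto simp: test_functions_def smooth_def)
qed

lemma sobolev0_if_continuous_vanishing:
  assumes "0 < \<beta>" "\<beta> < 2" and u: "u \<in> sobolev \<beta>"
    and v: "continuous_on UNIV v" and ae: "AE x in lborel. u x = v x"
    and inf: "(v \<longlongrightarrow> 0) at_infinity" and bound: "\<And>x. \<bar>v x\<bar> \<le> B" and v0: "v 0 = 0"
  shows "u \<in> sobolev0 \<beta>"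
proof -
  have [measurable]: "u \<in> borel_measurable borel" and int: "integrable lborel (\<lambda>x. (u x)\<^sup>2)"
    using u sobolev_iff[OF assms(1,2)] by auto
  have [measurable]: "v \<in> borel_measurable borel"
    by (rule borel_measurable_continuous_onI[OF v])
  define \<epsilon> :: "nat \<Rightarrow> real" where "\<epsilon> n = 1 / real (Suc n)" for n
  have \<epsilon>: "\<epsilon> n > 0" for n
    by (simp add: \<epsilon>_def)
  have \<epsilon>_lim: "\<epsilon> \<longlonglongrightarrow> 0"
    unfolding \<epsilon>_def using LIMSEQ_inverse_real_of_nat by (simp add: inverse_eq_divide)
  define w where "w n x = soft_threshold (\<epsilon> n) (v x)" for n x
  have w_cont: "continuous_on UNIV (w n)" for n
    unfolding w_def by (intro continuous_intros v)
  then have [measurable]: "w n \<in> borel_measurable borel" for n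
    by (rule borel_measurable_continuous_onI)
  have w_le: "(w n x)\<^sup>2 \<le> (v x)\<^sup>2" for n x
    using abs_soft_threshold_le[OF \<epsilon>] by (simp add: w_def flip: abs_le_square_iff)
  have "integrable lborel (\<lambda>x. (v x)\<^sup>2)"
    by (rule integrable_cong_AE_imp[OF int]) (use ae in auto)
  then have w_int: "integrable lborel (\<lambda>x. (w n x)\<^sup>2)" for n
    by (rule Bochner_Integration.integrable_bound) (use w_le in auto)
  have "\<exists>r R. 0 < r \<and> (\<forall>x. w n x \<noteq> 0 \<longrightarrow> r \<le> \<bar>x\<bar> \<and> \<bar>x\<bar> \<le> R)" for n
  proof -
    have "isCont v 0"
      using v by (simp add: continuous_on_eq_continuous_at)
    then obtain r where r: "r > 0" "\<And>x. \<bar>x\<bar> < r \<Longrightarrow> \<bar>v x\<bar> < \<epsilon> n"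
      using \<epsilon>[of n] v0 unfolding continuous_at_eps_delta by force
    obtain R where R: "\<And>x. R \<le> \<bar>x\<bar> \<Longrightarrow> \<bar>v x\<bar> < \<epsilon> n"
      using inf \<epsilon>[of n] unfolding Lim_at_infinity by (auto simp: dist_real_def)
    have "r \<le> \<bar>x\<bar> \<and> \<bar>x\<bar> \<le> R" if "w n x \<noteq> 0" for x
      using r(2)[of x] R[of x] soft_threshold_eq_0[of "v x" "\<epsilon> n"] that unfolding w_def by linarith
    then show ?thesis
      using r(1) by blast
  qed
  then obtain r R where r: "\<And>n. 0 < r n" and supp: "\<And>n x. w n x \<noteq> 0 \<Longrightarrow> r n \<le> \<bar>x\<bar> \<and> \<bar>x\<bar> \<le> R n"
    by metis
  \<comment> \<open>The term \<open>r n / 2\<close> keeps the mollified support away from 0, and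
    \<open>\<epsilon> n\<close> forces the scales to 0.\<close>
  define \<delta> where "\<delta> n = min (\<epsilon> n) (r n / 2)" for n
  have \<delta>: "0 < \<delta> n" "\<delta> n < r n" "\<delta> n \<le> \<epsilon> n" for n
    using \<epsilon>[of n] r[of n] by (auto simp: \<delta>_def)
  have \<delta>_lim: "\<delta> \<longlonglongrightarrow> 0"
    by (rule tendsto_sandwich[OF always_eventually always_eventually tendsto_const \<epsilon>_lim])
      (use \<delta> in \<open>auto intro: less_imp_le\<close>)
  define \<phi> where "\<phi> n = mollify (\<delta> n) (w n)" for n
  have test: "\<phi> n \<in> test_functions" for n
    unfolding \<phi>_def by (rule mollify_in_test_functions[OF w_cont supp \<delta>(1,2)])
  have lim: "(\<lambda>n. \<phi> n x) \<longlonglongrightarrow> v x" for x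
  proof -
    have "(\<lambda>n. \<integral>s. mollifier s * w n (x - \<delta> n * s) \<partial>lborel) \<longlonglongrightarrow> (\<integral>s. mollifier s * v x \<partial>lborel)"
    proof (rule integral_dominated_convergence)
      show "integrable lborel (\<lambda>s. mollifier s * B)"
        by (simp add: integrable_mollifier)
      show "AE s in lborel. norm (mollifier s * w n (x - \<delta> n * s)) \<le> mollifier s * B" for n
        using order_trans[OF abs_soft_threshold_le[OF \<epsilon>] bound]
        by (auto simp: abs_mult mollifier_nonneg w_def intro!: AE_I2 mult_left_mono)
      show "AE s in lborel. (\<lambda>n. mollifier s * w n (x - \<delta> n * s)) \<longlonglongrightarrow> mollifier s * v x"
      proof (intro AE_I2 tendsto_mult_left)
        fix s
        have "(\<lambda>n. x - \<delta> n * s) \<longlonglongrightarrow> x - 0 * s"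
          by (intro tendsto_intros \<delta>_lim)
        then have 1: "(\<lambda>n. v (x - \<delta> n * s)) \<longlonglongrightarrow> v x"
          using v continuous_on_tendsto_compose[OF v] by simp
        \<comment> \<open>The threshold error is at most \<open>\<epsilon> n\<close> at every point,
          so it does not matter that the argument moves with n.\<close>
        have 2: "(\<lambda>n. w n (x - \<delta> n * s) - v (x - \<delta> n * s)) \<longlonglongrightarrow> 0"
          by (rule Lim_null_comparison[OF _ \<epsilon>_lim]) (simp add: w_def soft_threshold_dist[OF \<epsilon>])
        show "(\<lambda>n. w n (x - \<delta> n * s)) \<longlonglongrightarrow> v x"
          using tendsto_add[OF 1 2] by simp
      qed
    qed measurable
    then show ?thesis
      by (simp add: \<phi>_def mollify_def integral_mollifier)
  qed
  have "(\<lambda>n. sobolev_norm \<beta> (\<lambda>x. u x - \<phi> n x)) \<longlonglongrightarrow> 0"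
  proof (rule sobolev_norm_approximation[OF assms(1,2) u])
    show "\<phi> n \<in> borel_measurable borel" for n
      unfolding \<phi>_def by measurable
    show "AE x in lborel. (\<lambda>n. \<phi> n x) \<longlonglongrightarrow> u x"
      using ae by eventually_elim (simp add: lim)
    fix n
    have "(\<integral>\<^sup>+x. ennreal ((\<phi> n x)\<^sup>2) \<partial>lborel) \<le> (\<integral>\<^sup>+x. ennreal ((w n x)\<^sup>2) \<partial>lborel)"
      unfolding \<phi>_def by (intro nn_integral_mollify_square_le w_int \<delta>) measurable
    also have "\<dots> \<le> (\<integral>\<^sup>+x. ennreal ((v x)\<^sup>2) \<partial>lborel)"
      by (intro nn_integral_mono ennreal_leI w_le)
    also have "\<dots> = (\<integral>\<^sup>+x. ennreal ((u x)\<^sup>2) \<partial>lborel)"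
      by (rule nn_integral_cong_AE) (use ae in eventually_elim, simp)
    finally show "(\<integral>\<^sup>+x. ennreal ((\<phi> n x)\<^sup>2) \<partial>lborel) \<le> (\<integral>\<^sup>+x. ennreal ((u x)\<^sup>2) \<partial>lborel)" .
    have "gagliardo \<beta> (\<phi> n) \<le> gagliardo \<beta> (w n)"
      unfolding \<phi>_def by (intro gagliardo_mollify_le w_int \<delta>) measurable
    also have "\<dots> \<le> gagliardo \<beta> v"
      unfolding w_def by (intro gagliardo_mono soft_threshold_contraction \<epsilon>)
    also have "\<dots> = gagliardo \<beta> u"
      by (rule gagliardo_cong_AE[OF ae, symmetric])
    finally show "gagliardo \<beta> (\<phi> n) \<le> gagliardo \<beta> u" .
  qed
  then show ?thesis
    using u test by (auto simp: sobolev0_def)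
qed

text \<open>For the inclusion from left to right: test functions vanish at 0, so the continuous
  representative of u - \<phi> n has the value v 0 there for every n. The embedding bounds |v 0| by
  a multiple of a norm that tends to 0.\<close>

lemma sobolev0_eq_vanishing:
  assumes "1 < \<beta>" "\<beta> < 2"
  shows "sobolev0 \<beta> = {u \<in> sobolev \<beta>. continuous_representative u 0 = 0}"
proof (intro set_eqI iffI)
  obtain C where "C \<ge> 0" and emb: "\<And>u. u \<in> sobolev \<beta> \<Longrightarrow>
      \<exists>v. continuous_on UNIV v \<and> (AE x in lborel. u x = v x) \<and> (v \<longlongrightarrow> 0) at_infinity \<and>
        (\<forall>x. \<bar>v x\<bar> \<le> C * (sqrt (\<integral>t. (u t)\<^sup>2 \<partial>lborel) + sqrt (enn2real (gagliardo \<beta> u))))"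
    using sobolev_embedding[OF assms] by blast
  have \<beta>: "0 < \<beta>"
    using assms by simp
  {
    fix u assume "u \<in> {u \<in> sobolev \<beta>. continuous_representative u 0 = 0}"
    then have u: "u \<in> sobolev \<beta>" "continuous_representative u 0 = 0"
      by auto
    from emb[OF u(1)] obtain v where v: "continuous_on UNIV v" "AE x in lborel. u x = v x"
        "(v \<longlongrightarrow> 0) at_infinity"
        "\<And>x. \<bar>v x\<bar> \<le> C * (sqrt (\<integral>t. (u t)\<^sup>2 \<partial>lborel) + sqrt (enn2real (gagliardo \<beta> u)))"
      by blast
    show "u \<in> sobolev0 \<beta>"
      using sobolev0_if_continuous_vanishing[OF \<beta> assms(2) u(1) v] u(2)
        continuous_representative_eq[OF v(1,2)] by simp
  next
    fix u assume "u \<in> sobolev0 \<beta>"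
    then obtain \<phi> where u: "u \<in> sobolev \<beta>" and \<phi>: "\<And>n :: nat. \<phi> n \<in> test_functions"
      and lim: "(\<lambda>n. sobolev_norm \<beta> (\<lambda>x. u x - \<phi> n x)) \<longlonglongrightarrow> 0"
      by (auto simp: sobolev0_def)
    from emb[OF u] obtain v where v: "continuous_on UNIV v" "AE x in lborel. u x = v x"
      by blast
    define N where "N n = sobolev_norm \<beta> (\<lambda>x. u x - \<phi> n x)" for n
    define c where "c = 2 / kernel_const \<beta>"
    have "\<bar>v 0\<bar> \<le> C * (N n + sqrt c * N n)" for n
    proof -
      have N: "N n \<ge> 0"
        by (simp add: N_def sobolev_norm_def)
      let ?h = "\<lambda>x. u x - \<phi> n x"
      \<comment> \<open>Without finite energy of the difference, \<open>N n\<close> would not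
        dominate it.\<close>
      have h: "?h \<in> sobolev \<beta>"
        by (intro sobolev_diff \<beta> assms u test_function_in_sobolev \<phi>)
      from emb[OF h] obtain z where z: "continuous_on UNIV z" "AE x in lborel. ?h x = z x"
          "\<bar>z 0\<bar> \<le> C * (sqrt (\<integral>t. (?h t)\<^sup>2 \<partial>lborel) + sqrt (enn2real (gagliardo \<beta> ?h)))"
        by blast
      have "continuous_on UNIV (\<lambda>x. v x - \<phi> n x)"
        by (intro continuous_intros v smooth_continuous_on test_function_smooth \<phi>)
      moreover have "AE x in lborel. z x = v x - \<phi> n x"
        using z(2) v(2) by eventually_elim simp
      ultimately have "z = (\<lambda>x. v x - \<phi> n x)"
        using continuous_AE_eq_imp_eq[OF z(1)] by blast
      then have "z 0 = v 0"
        by (simp add: test_function_0[OF \<phi>])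
      moreover have "sqrt (\<integral>t. (?h t)\<^sup>2 \<partial>lborel) \<le> N n"
        using real_sqrt_le_mono[OF sobolev_norm_bounds(1)[OF \<beta> assms(2) h]] N by (simp add: N_def)
      moreover have "sqrt (enn2real (gagliardo \<beta> ?h)) \<le> sqrt (c * (N n)\<^sup>2)"
        unfolding N_def c_def by (rule real_sqrt_le_mono[OF sobolev_norm_bounds(2)[OF \<beta> assms(2) h]])
      then have "sqrt (enn2real (gagliardo \<beta> ?h)) \<le> sqrt c * N n"
        using N by (simp add: real_sqrt_mult)
      ultimately show ?thesis
        using order_trans[OF z(3) mult_left_mono[OF add_mono \<open>C \<ge> 0\<close>]] by simp
    qed
    moreover have "(\<lambda>n. C * (N n + sqrt c * N n)) \<longlonglongrightarrow> C * (0 + sqrt c * 0)"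
      unfolding N_def by (intro tendsto_intros lim)
    ultimately have "\<bar>v 0\<bar> \<le> C * (0 + sqrt c * 0)"
      by (intro LIMSEQ_le_const) auto
    then show "u \<in> {u \<in> sobolev \<beta>. continuous_representative u 0 = 0}"
      using u continuous_representative_eq[OF v] by simp
  }
qed

theorem corollary6p4:
  fixes \<alpha> :: real
  assumes "1 < \<alpha>" and "\<alpha> < 2"
  shows "sobolev0 \<alpha> = sobolev \<alpha> \<inter> (\<Inter>\<beta>\<in>{1<..<\<alpha>}. sobolev0 \<beta>) \<and>
         sobolev0 \<alpha> = {u \<in> sobolev \<alpha>. continuous_representative u 0 = 0}"
proof
  show *: "sobolev0 \<alpha> = {u \<in> sobolev \<alpha>. continuous_representative u 0 = 0}"
    by (rule sobolev0_eq_vanishing[OF assms])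
  have sobolev0_\<beta>: "sobolev0 \<beta> = {u \<in> sobolev \<beta>. continuous_representative u 0 = 0}"
    if "\<beta> \<in> {1<..<\<alpha>}" for \<beta>
    using that assms by (intro sobolev0_eq_vanishing) auto
  have sobolev_le: "sobolev \<alpha> \<subseteq> sobolev \<beta>" if "\<beta> \<in> {1<..<\<alpha>}" for \<beta>
    using that assms by (intro sobolev_antimono) auto
  \<comment> \<open>One exponent strictly between 1 and \<alpha> already yields the condition at 0;
    the midpoint serves as a witness.\<close>
  have mid: "(1 + \<alpha>) / 2 \<in> {1<..<\<alpha>}"
    using assms by simp
  show "sobolev0 \<alpha> = sobolev \<alpha> \<inter> (\<Inter>\<beta>\<in>{1<..<\<alpha>}. sobolev0 \<beta>)"
  proof (intro equalityI subsetI IntI INT_I)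
    fix u assume u: "u \<in> sobolev0 \<alpha>"
    then show "u \<in> sobolev \<alpha>"
      by (simp add: *)
    show "u \<in> sobolev0 \<beta>" if "\<beta> \<in> {1<..<\<alpha>}" for \<beta>
      using u sobolev_le[OF that] unfolding * sobolev0_\<beta>[OF that] by blast
  next
    fix u assume "u \<in> sobolev \<alpha> \<inter> (\<Inter>\<beta>\<in>{1<..<\<alpha>}. sobolev0 \<beta>)"
    then have "u \<in> sobolev \<alpha>" "u \<in> sobolev0 ((1 + \<alpha>) / 2)"
      using mid by blast+
    then show "u \<in> sobolev0 \<alpha>"
      unfolding * sobolev0_\<beta>[OF mid] by blast
  qed
qed

end
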